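(* Let $J\subseteq I$, $\nu\in\Lambda_{\Phi_J}^+$, and write $\nu=\sum_{j\in J}\nu_j\omega_j^J$. Suppose $R$ is a $\Phi_J$-structured poset. Suppose also that $\mathrm{WGF}(R)|_J$ is $W_J$-invariant. (In this setting, the latter is guaranteed if, for example, for all $j\in J$ the $j$-components of $R$ are rank symmetric.) Let $\mathcal S=\mathcal S_{J,\nu}(R)$ be a subset of $\{\mathbf x\in R:\delta_j(\mathbf x)\le\nu_j\text{ for all }j\in J\}$. Suppose $\kappa:R\setminus\mathcal S\to J$ is a vertex-coloring function such that for each $\mathbf x\in R\setminus\mathcal S$ with $k:=\kappa(\mathbf x)$ we have (1) $\mathrm{comp}_k(\mathbf x)$ is isomorphic to a product of chains and (2) $\mathsf K(\mathbf x)$ is a $(\nu_k+1)$-sub-block of $\mathrm{comp}_k(\mathbf x)$. Then $\nu+wt^J(\mathbf s)\in\Lambda_{\Phi_J}^+$ for all $\mathbf s\in\mathcal S$ and $R$ is a $(J,\nu)$-splitting poset with $$\chi^{\Phi_J}_\nu\cdot\mathrm{WGF}(R)|_J=\sum_{\mathbf s\in\mathcal S_{J,\nu}(R)}\chi^{\Phi_J}_{\nu+wt^J(\mathbf s)}.$$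
   Context: Root systems. $\Phi$ is a finite (reduced, crystallographic) root system in a Euclidean space with simple roots $\{\alpha_i\}_{i\in I}$, $\alpha^\vee=2\alpha/\langle\alpha,\alpha\rangle$, fundamental weights $\omega_i$ dual to simple coroots, $\Lambda=\bigoplus\mathbb Z\omega_i$, $\Lambda^+=\bigoplus\mathbb Z_{\ge0}\omega_i$, Weyl group $W$, $\varrho=\sum\omega_i$. $\mathbb Z[\Lambda]$ is the group ring with basis $\{e^\mu\}$, $w.e^\mu=e^{w(\mu)}$; $\mathcal A(e^\mu)=\sum_{w\in W}\det(w)e^{w(\mu)}$. For $\lambda\in\Lambda^+$ the Weyl bialternant $\chi_\lambda$ is the unique element of $\mathbb Z[\Lambda]$ with $\mathcal A(e^\varrho)\chi_\lambda=\mathcal A(e^{\lambda+\varrho})$. For $J\subseteq I$, $\Phi_J$ is the root subsystem with simple roots $\{\alpha_j\}_{j\in J}$, with Weyl group $W_J$, fundamental weights $\omega_j^J$, weight lattice $\Lambda_{\Phi_J}$, dominant weights $\Lambda_{\Phi_J}^+$, bialternants $\chi^{\Phi_J}_\nu$. For $\mu=\sum m_i\omega_i$ put $\mu^J=\sum_{j\in J}m_j\omega_j^J$, and for $\chi=\sum c_\mu e^\mu$ put $\chi|_J=\sum c_\mu e^{\mu^J}$. Posets. All posets are finite, identified with Hasse diagrams. Ranked means there is a surjection $\rho:R\to\{0,\dots,l\}$ with $\rho(\mathbf s)+1=\rho(\mathbf t)$ whenever $\mathbf t$ covers $\mathbf s$; $l$ is the length; the poset is rank symmetric if $|\rho^{-1}(i)|=|\rho^{-1}(l-i)|$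 for $0\le i\le l$. $R$ is a ranked poset with Hasse edges colored by $I$. The $i$-component $\mathrm{comp}_i(\mathbf x)$ is the connected component of $\mathbf x$ using only color $i$ edges; $\rho_i(\mathbf x)$ is the rank of $\mathbf x$ there, $l_i(\mathbf x)$ the length of this component, $\delta_i=l_i-\rho_i$, $m_i=\rho_i-\delta_i$, $wt^J(\mathbf x)=\sum_{j\in J}m_j(\mathbf x)\omega_j^J$, $wt=wt^I$, $\mathrm{WGF}(R)=\sum_{\mathbf x}e^{wt(\mathbf x)}$. $R$ is $\Phi$-structured if $wt(\mathbf s)+\alpha_i=wt(\mathbf t)$ whenever $\mathbf s\xrightarrow{i}\mathbf t$ in $R$, and $\Phi_J$-structured if $wt^J(\mathbf s)+\alpha_j=wt^J(\mathbf t)$ whenever $\mathbf s\xrightarrow{j}\mathbf t$ with $j\in J$. A $(J,\nu)$-splitting poset is defined to be a $\Phi$-structured poset $R$ together with a set $\mathcal S_{J,\nu}(R)\subseteq R$ for which $\nu+wt^J(\mathbf s)\in\Lambda^+_{\Phi_J}$ for all $\mathbf s\in\mathcal S_{J,\nu}(R)$ and $\chi^{\Phi_J}_\nu\cdot\mathrm{WGF}(R)|_J=\sum_{\mathbf s\in\mathcal S_{J,\nu}(R)}\chi^{\Phi_J}_{\nu+wt^J(\mathbf s)}$. Kindred sets. Given $\mathcal S\subseteq R$ and $\kappa:R\setminus\mathcal S\to J$, the kindred set of $\mathbf x\in R\setminus\mathcal S$ is $\mathsf K(\mathbf x)=\{\mathbf y\in\mathrm{comp}_{\kappa(\mathbf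 x)}(\mathbf x):\mathbf y\in R\setminus\mathcal S,\ \kappa(\mathbf y)=\kappa(\mathbf x)\}$. Sub-blocks. Let $\mathcal C=\mathcal C_1\times\cdots\times\mathcal C_p$ be a product of chains and $b$ a positive integer. If for some $q\in\{1,\dots,p\}$ we have $\sum_{r=q+1}^p(|\mathcal C_r|-1)<b\le\sum_{r=q}^p(|\mathcal C_r|-1)$, the $b$-sub-block of $\mathcal C$ is the set of $(\mathbf x_1,\dots,\mathbf x_p)\in\mathcal C$ such that $\mathbf x_{q+1},\dots,\mathbf x_p$ are minimal in $\mathcal C_{q+1},\dots,\mathcal C_p$ respectively and $\mathbf x_q$ has depth (number of steps below the top) at least $b-\sum_{r=q+1}^p(|\mathcal C_r|-1)$ in $\mathcal C_q$; it is empty if $b>\sum_{r=1}^p(|\mathcal C_r|-1)$. If $\phi:\mathcal C\to P$ is a poset isomorphism, then $S\subseteq P$ is a $b$-sub-block of $P$ if $\phi^{-1}(S)$ is the $b$-sub-block of $\mathcal C$.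
   Formalization: That R is a (J,ν)-splitting poset is concluded only when R is Φ-structured, as the definition demands; Φ_J-structured alone does not give this (e.g. J empty). Dominance and the displayed identity are proved for every Φ_J-structured R. *)

theory Defs
  imports "HOL-Analysis.Analysis" "HOL-Library.Poly_Mapping"
begin

section \<open>Root systems and weights\<close>

definition coroot :: "real^'n \<Rightarrow> real^'n" where
  "coroot a = (2 / (a \<bullet> a)) *\<^sub>R a"

definition root_reflection :: "real^'n \<Rightarrow> real^'n \<Rightarrow> real^'n" where
  "root_reflection a x = x - (x \<bullet> coroot a) *\<^sub>R a"

text \<open>
  A root system is not required to span the ambient space: its Euclidean space is \<open>span \<Phi>\<close>.
  So a root subsystem is a root system without a change of ambient space, and the empty root
  system is allowed.
\<close>

definition root_system :: "(real^'n) set \<Rightarrow> bool" where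
  "root_system \<Phi> \<longleftrightarrow> finite \<Phi> \<and> 0 \<notin> \<Phi> \<and>
     (\<forall>a\<in>\<Phi>. root_reflection a ` \<Phi> = \<Phi>) \<and>
     (\<forall>a\<in>\<Phi>. \<forall>b\<in>\<Phi>. b \<bullet> coroot a \<in> \<int>) \<and>
     (\<forall>a\<in>\<Phi>. \<forall>c. c *\<^sub>R a \<in> \<Phi> \<longrightarrow> c = 1 \<or> c = -1)"

definition simple_roots :: "(real^'n) set \<Rightarrow> 'i set \<Rightarrow> ('i \<Rightarrow> real^'n) \<Rightarrow> bool" where
  "simple_roots \<Phi> I \<alpha> \<longleftrightarrow> finite I \<and> inj_on \<alpha> I \<and> \<alpha> ` I \<subseteq> \<Phi> \<and> independent (\<alpha> ` I) \<and>
     (\<forall>b\<in>\<Phi>. \<exists>c :: 'i \<Rightarrow> nat.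
        b = (\<Sum>i\<in>I. real (c i) *\<^sub>R \<alpha> i) \<or> b = - (\<Sum>i\<in>I. real (c i) *\<^sub>R \<alpha> i))"

text \<open>
  In what follows the data attached to \<open>\<Phi>\<^sub>J\<close> are functions of \<open>J\<close>; the data of \<open>\<Phi>\<close> itself
  are the case \<open>J = I\<close>.
\<close>

definition root_subsystem :: "(real^'n) set \<Rightarrow> ('i \<Rightarrow> real^'n) \<Rightarrow> 'i set \<Rightarrow> (real^'n) set" where
  "root_subsystem \<Phi> \<alpha> J = \<Phi> \<inter> span (\<alpha> ` J)"

inductive_set weyl_group :: "(real^'n) set \<Rightarrow> (real^'n \<Rightarrow> real^'n) set" for \<Phi> where
  weyl_id: "id \<in> weyl_group \<Phi>"
| weyl_step: "w \<in> weyl_group \<Phi> \<Longrightarrow> a \<in> \<Phi> \<Longrightarrow> root_reflection a \<circ> w \<in> weyl_group \<Phi>"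

text \<open>\<open>fund_weight \<alpha> J j\<close> is \<open>\<omega>\<^sub>j\<^sup>J\<close>; the condition on the span makes it unique.\<close>

definition fund_weight :: "('i \<Rightarrow> real^'n) \<Rightarrow> 'i set \<Rightarrow> 'i \<Rightarrow> real^'n" where
  "fund_weight \<alpha> J j = (THE w. w \<in> span (\<alpha> ` J) \<and>
     (\<forall>k\<in>J. w \<bullet> coroot (\<alpha> k) = (if k = j then 1 else 0)))"

definition weights :: "('i \<Rightarrow> real^'n) \<Rightarrow> 'i set \<Rightarrow> (real^'n) set" where
  "weights \<alpha> J = {\<Sum>j\<in>J. real_of_int (m j) *\<^sub>R fund_weight \<alpha> J j | m :: 'i \<Rightarrow> int. True}"

definition dominant_weights :: "('i \<Rightarrow> real^'n) \<Rightarrow> 'i set \<Rightarrow> (real^'n) set" where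
  "dominant_weights \<alpha> J = {\<Sum>j\<in>J. real (m j) *\<^sub>R fund_weight \<alpha> J j | m :: 'i \<Rightarrow> nat. True}"

definition weyl_vector :: "('i \<Rightarrow> real^'n) \<Rightarrow> 'i set \<Rightarrow> real^'n" where
  "weyl_vector \<alpha> J = (\<Sum>j\<in>J. fund_weight \<alpha> J j)"


section \<open>The group ring and Weyl bialternants\<close>

text \<open>
  The group ring of a lattice of weights consists of the elements of \<open>(real^'n) \<Rightarrow>\<^sub>0 int\<close>
  (with the convolution product of \<open>Poly_Mapping\<close>) supported on that lattice.  The basis
  element \<open>e\<^sup>\<mu>\<close> is \<open>frag_of \<mu>\<close>, and \<open>frag_extend\<close> is linear extension from the basis.
\<close>

definition map_exponents ::
    "(real^'n \<Rightarrow> real^'n) \<Rightarrow> (real^'n \<Rightarrow>\<^sub>0 int) \<Rightarrow> (real^'n \<Rightarrow>\<^sub>0 int)" where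
  "map_exponents f = frag_extend (\<lambda>\<mu>. frag_of (f \<mu>))"

definition weyl_invariant :: "(real^'n) set \<Rightarrow> (real^'n \<Rightarrow>\<^sub>0 int) \<Rightarrow> bool" where
  "weyl_invariant \<Phi> \<xi> \<longleftrightarrow> (\<forall>w\<in>weyl_group \<Phi>. map_exponents w \<xi> = \<xi>)"

text \<open>
  \<open>alternant \<Phi> \<mu>\<close> is \<open>\<A>(e\<^sup>\<mu>)\<close>.  A Weyl group element fixes the orthogonal complement of
  \<open>span \<Phi>\<close>, so its determinant on the ambient space is the one on \<open>span \<Phi>\<close>; it is 1 or -1,
  and the floor only changes its type.
\<close>

definition alternant :: "(real^'n) set \<Rightarrow> real^'n \<Rightarrow> (real^'n \<Rightarrow>\<^sub>0 int)" where
  "alternant \<Phi> \<mu> = (\<Sum>w\<in>weyl_group \<Phi>. frag_cmul \<lfloor>det (matrix w)\<rfloor> (frag_of (w \<mu>)))"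

definition bialternant ::
    "(real^'n) set \<Rightarrow> ('i \<Rightarrow> real^'n) \<Rightarrow> 'i set \<Rightarrow> real^'n \<Rightarrow> (real^'n \<Rightarrow>\<^sub>0 int)" where
  "bialternant \<Phi> \<alpha> J \<mu> = (THE \<xi>. Poly_Mapping.keys \<xi> \<subseteq> weights \<alpha> J \<and>
     alternant (root_subsystem \<Phi> \<alpha> J) (weyl_vector \<alpha> J) * \<xi> =
     alternant (root_subsystem \<Phi> \<alpha> J) (\<mu> + weyl_vector \<alpha> J))"

text \<open>
  The coefficient of \<open>\<omega>\<^sub>j\<close> in a weight \<open>\<mu>\<close> is \<open>\<mu> \<bullet> coroot (\<alpha> j)\<close>, so
  \<open>restrict_weight \<alpha> J \<mu>\<close> is \<open>\<mu>\<^sup>J\<close>.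
\<close>

definition restrict_weight :: "('i \<Rightarrow> real^'n) \<Rightarrow> 'i set \<Rightarrow> real^'n \<Rightarrow> real^'n" where
  "restrict_weight \<alpha> J \<mu> = (\<Sum>j\<in>J. (\<mu> \<bullet> coroot (\<alpha> j)) *\<^sub>R fund_weight \<alpha> J j)"

definition restrict_char ::
    "('i \<Rightarrow> real^'n) \<Rightarrow> 'i set \<Rightarrow> (real^'n \<Rightarrow>\<^sub>0 int) \<Rightarrow> (real^'n \<Rightarrow>\<^sub>0 int)" where
  "restrict_char \<alpha> J = map_exponents (restrict_weight \<alpha> J)"


section \<open>Ranked posets with colored edges\<close>

text \<open>A poset is a carrier \<open>A\<close> with an order relation \<open>r \<subseteq> A \<times> A\<close> (\<open>partial_order_on A r\<close>).\<close>

definition covered_by :: "'p rel \<Rightarrow> 'p \<Rightarrow> 'p \<Rightarrow> bool" where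
  "covered_by r s t \<longleftrightarrow> (s, t) \<in> r \<and> s \<noteq> t \<and> (\<forall>u. (s, u) \<in> r \<and> (u, t) \<in> r \<longrightarrow> u = s \<or> u = t)"

definition rank_function :: "'p set \<Rightarrow> 'p rel \<Rightarrow> ('p \<Rightarrow> nat) \<Rightarrow> nat \<Rightarrow> bool" where
  "rank_function A r \<rho> l \<longleftrightarrow> \<rho> ` A = {0..l} \<and> (\<forall>s t. covered_by r s t \<longrightarrow> \<rho> s + 1 = \<rho> t)"

definition rank_symmetric :: "'p set \<Rightarrow> 'p rel \<Rightarrow> bool" where
  "rank_symmetric A r \<longleftrightarrow> (\<exists>\<rho> l. rank_function A r \<rho> l \<and>
     (\<forall>i\<le>l. card {x\<in>A. \<rho> x = i} = card {x\<in>A. \<rho> x = l - i}))"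

text \<open>The rank function is unique when the Hasse diagram is connected, as for the components below.\<close>

definition poset_rank :: "'p set \<Rightarrow> 'p rel \<Rightarrow> 'p \<Rightarrow> nat" where
  "poset_rank A r x = (THE k. \<exists>\<rho> l. rank_function A r \<rho> l \<and> k = \<rho> x)"

definition poset_length :: "'p set \<Rightarrow> 'p rel \<Rightarrow> nat" where
  "poset_length A r = (THE l. \<exists>\<rho>. rank_function A r \<rho> l)"

text \<open>The edge \<open>s \<rightarrow> t\<close> has color \<open>col s t\<close>; values of \<open>col\<close> at other pairs are irrelevant.\<close>

definition colored_ranked_poset :: "'i set \<Rightarrow> 'p set \<Rightarrow> 'p rel \<Rightarrow> ('p \<Rightarrow> 'p \<Rightarrow> 'i) \<Rightarrow> bool" where
  "colored_ranked_poset I R r col \<longleftrightarrow> finite R \<and> partial_order_on R r \<and>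
     (\<exists>\<rho> l. rank_function R r \<rho> l) \<and> (\<forall>s t. covered_by r s t \<longrightarrow> col s t \<in> I)"

definition color_edges :: "'p rel \<Rightarrow> ('p \<Rightarrow> 'p \<Rightarrow> 'i) \<Rightarrow> 'i \<Rightarrow> 'p rel" where
  "color_edges r col i = {(s, t). covered_by r s t \<and> col s t = i}"

definition component :: "'p rel \<Rightarrow> ('p \<Rightarrow> 'p \<Rightarrow> 'i) \<Rightarrow> 'i \<Rightarrow> 'p \<Rightarrow> 'p set" where
  "component r col i x = {y. (x, y) \<in> (color_edges r col i \<union> (color_edges r col i)\<inverse>)\<^sup>*}"

text \<open>The order on a component is the one whose Hasse diagram consists of its color \<open>i\<close> edges.\<close>

definition component_order :: "'p rel \<Rightarrow> ('p \<Rightarrow> 'p \<Rightarrow> 'i) \<Rightarrow> 'i \<Rightarrow> 'p \<Rightarrow> 'p rel" where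
  "component_order r col i x = Restr ((color_edges r col i)\<^sup>*) (component r col i x)"

definition comp_rank :: "'p rel \<Rightarrow> ('p \<Rightarrow> 'p \<Rightarrow> 'i) \<Rightarrow> 'i \<Rightarrow> 'p \<Rightarrow> nat" where
  "comp_rank r col i x = poset_rank (component r col i x) (component_order r col i x) x"

definition comp_length :: "'p rel \<Rightarrow> ('p \<Rightarrow> 'p \<Rightarrow> 'i) \<Rightarrow> 'i \<Rightarrow> 'p \<Rightarrow> nat" where
  "comp_length r col i x = poset_length (component r col i x) (component_order r col i x)"

definition comp_depth :: "'p rel \<Rightarrow> ('p \<Rightarrow> 'p \<Rightarrow> 'i) \<Rightarrow> 'i \<Rightarrow> 'p \<Rightarrow> int" where
  "comp_depth r col i x = int (comp_length r col i x) - int (comp_rank r col i x)"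

definition comp_weight :: "'p rel \<Rightarrow> ('p \<Rightarrow> 'p \<Rightarrow> 'i) \<Rightarrow> 'i \<Rightarrow> 'p \<Rightarrow> int" where
  "comp_weight r col i x = int (comp_rank r col i x) - comp_depth r col i x"

text \<open>\<open>wt \<alpha> J r col x\<close> is \<open>wt\<^sup>J(x)\<close>.\<close>

definition wt ::
    "('i \<Rightarrow> real^'n) \<Rightarrow> 'i set \<Rightarrow> 'p rel \<Rightarrow> ('p \<Rightarrow> 'p \<Rightarrow> 'i) \<Rightarrow> 'p \<Rightarrow> real^'n" where
  "wt \<alpha> J r col x = (\<Sum>j\<in>J. real_of_int (comp_weight r col j x) *\<^sub>R fund_weight \<alpha> J j)"

definition WGF ::
    "('i \<Rightarrow> real^'n) \<Rightarrow> 'i set \<Rightarrow> 'p set \<Rightarrow> 'p rel \<Rightarrow> ('p \<Rightarrow> 'p \<Rightarrow> 'i) \<Rightarrow> (real^'n \<Rightarrow>\<^sub>0 int)" where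
  "WGF \<alpha> I R r col = (\<Sum>x\<in>R. frag_of (wt \<alpha> I r col x))"

definition structured :: "('i \<Rightarrow> real^'n) \<Rightarrow> 'i set \<Rightarrow> 'p rel \<Rightarrow> ('p \<Rightarrow> 'p \<Rightarrow> 'i) \<Rightarrow> bool" where
  "structured \<alpha> J r col \<longleftrightarrow> (\<forall>s t j. j \<in> J \<and> covered_by r s t \<and> col s t = j \<longrightarrow>
     wt \<alpha> J r col s + \<alpha> j = wt \<alpha> J r col t)"

definition splitting_poset ::
    "(real^'n) set \<Rightarrow> ('i \<Rightarrow> real^'n) \<Rightarrow> 'i set \<Rightarrow> 'i set \<Rightarrow> real^'n \<Rightarrow>
     'p set \<Rightarrow> 'p rel \<Rightarrow> ('p \<Rightarrow> 'p \<Rightarrow> 'i) \<Rightarrow> 'p set \<Rightarrow> bool" where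
  "splitting_poset \<Phi> \<alpha> I J \<nu> R r col S \<longleftrightarrow>
     colored_ranked_poset I R r col \<and> structured \<alpha> I r col \<and> S \<subseteq> R \<and>
     (\<forall>s\<in>S. \<nu> + wt \<alpha> J r col s \<in> dominant_weights \<alpha> J) \<and>
     bialternant \<Phi> \<alpha> J \<nu> * restrict_char \<alpha> J (WGF \<alpha> I R r col) =
       (\<Sum>s\<in>S. bialternant \<Phi> \<alpha> J (\<nu> + wt \<alpha> J r col s))"

text \<open>For \<open>x\<close> and \<open>\<kappa>\<close> as in \<open>R - S\<close> and \<open>\<kappa> : R - S \<rightarrow> J\<close>; \<open>\<kappa>\<close> is not consulted on \<open>S\<close>.\<close>

definition kindred ::
    "'p set \<Rightarrow> 'p rel \<Rightarrow> ('p \<Rightarrow> 'p \<Rightarrow> 'i) \<Rightarrow> 'p set \<Rightarrow> ('p \<Rightarrow> 'i) \<Rightarrow> 'p \<Rightarrow> 'p set" where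
  "kindred R r col S \<kappa> x = {y \<in> component r col (\<kappa> x) x. y \<in> R - S \<and> \<kappa> y = \<kappa> x}"


section \<open>Products of chains and sub-blocks\<close>

text \<open>
  The list \<open>ns = [n\<^sub>1, \<dots>, n\<^sub>p]\<close> stands for the product of the chains \<open>{0..n\<^sub>1}, \<dots>, {0..n\<^sub>p}\<close>,
  so that \<open>n\<^sub>q\<close> is \<open>|\<C>\<^sub>q| - 1\<close>; list positions are counted from 0.
\<close>

definition chain_product :: "nat list \<Rightarrow> nat list set" where
  "chain_product ns = {xs. length xs = length ns \<and> (\<forall>q<length ns. xs ! q \<le> ns ! q)}"

definition chain_product_order :: "nat list \<Rightarrow> nat list rel" where
  "chain_product_order ns = {(xs, ys). xs \<in> chain_product ns \<and> ys \<in> chain_product ns \<and>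
     (\<forall>q<length ns. xs ! q \<le> ys ! q)}"

definition poset_iso :: "'a set \<Rightarrow> 'a rel \<Rightarrow> 'b set \<Rightarrow> 'b rel \<Rightarrow> ('a \<Rightarrow> 'b) \<Rightarrow> bool" where
  "poset_iso A r B r' \<phi> \<longleftrightarrow> bij_betw \<phi> A B \<and>
     (\<forall>x\<in>A. \<forall>y\<in>A. (x, y) \<in> r \<longleftrightarrow> (\<phi> x, \<phi> y) \<in> r')"

definition iso_chain_product :: "'p set \<Rightarrow> 'p rel \<Rightarrow> bool" where
  "iso_chain_product P r \<longleftrightarrow>
     (\<exists>ns \<phi>. poset_iso (chain_product ns) (chain_product_order ns) P r \<phi>)"

text \<open>
  There is no suitable \<open>q\<close>, and the sub-block is empty, if \<open>b > sum_list ns\<close>; otherwise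
  \<open>q\<close> is unique (for \<open>b > 0\<close>).
\<close>

definition sub_block :: "nat list \<Rightarrow> nat \<Rightarrow> nat list set" where
  "sub_block ns b = {xs \<in> chain_product ns. \<exists>q<length ns.
     (\<Sum>k\<in>{q<..<length ns}. ns ! k) < b \<and> b \<le> (\<Sum>k\<in>{q..<length ns}. ns ! k) \<and>
     (\<forall>k\<in>{q<..<length ns}. xs ! k = 0) \<and>
     ns ! q - xs ! q \<ge> b - (\<Sum>k\<in>{q<..<length ns}. ns ! k)}"

definition is_sub_block :: "'p set \<Rightarrow> 'p rel \<Rightarrow> nat \<Rightarrow> 'p set \<Rightarrow> bool" where
  "is_sub_block P r b S \<longleftrightarrow> S \<subseteq> P \<and>
     (\<exists>ns \<phi>. poset_iso (chain_product ns) (chain_product_order ns) P r \<phi> \<and>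
        {xs \<in> chain_product ns. \<phi> xs \<in> S} = sub_block ns b)"

end

theory Submission
  imports Defs
begin

text \<open>
  Multiplying by the Weyl denominator turns the claim into an identity of alternants. As
  \<open>WGF(R)|\<^sub>J\<close> is \<open>W\<^sub>J\<close>-invariant, its product with \<open>\<A>(e\<^sup>\<nu>\<^sup>+\<^sup>\<rho>)\<close> is the sum of the alternants of
  \<open>\<nu> + \<rho> + wt\<^sup>J(x)\<close> over all \<open>x\<close> in \<open>R\<close>. The terms outside \<open>S\<close> cancel within each kindred set \<open>K\<close>
  of color \<open>k\<close>: a sub-block is again a product of chains, and taking complements in it sends rank
  \<open>i\<close> to \<open>l - (\<nu>\<^sub>k + 1) - i\<close>, where \<open>l\<close> is the length of the component; on the weights
  \<open>\<nu> + \<rho> + wt\<^sup>J(x)\<close> this is the simple reflection in \<open>\<alpha>\<^sub>k\<close>, which changes the sign of the alternant.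
  Returning to bialternants needs that the Weyl denominator divides every alternant and is not a
  zero divisor; both follow from leading term arguments.
\<close>

section \<open>Reflections\<close>

text \<open>Both leading term arguments rest on one fact: for dominant \<open>x\<close> and
  \<open>w\<close> in the Weyl group, \<open>x - w x\<close> is a nonnegative combination of simple
  roots, and its pairing with \<open>\<rho>\<close> is positive unless it is 0. The obstacle is that
  \<open>weyl_group\<close> is generated by the reflections in all roots. Words in simple
  reflections and an exchange property bridge this gap, with the length of a word as induction
  measure. Divisibility and cancellation are both needed because \<open>bialternant\<close> is a
  definite description.

  The bound in the sub-blocks exceeds the coefficient of \<open>\<nu>\<close> by 1 because it is the
  pairing of \<open>\<nu> + \<rho>\<close>, not of \<open>\<nu>\<close>, with the simple coroot. A
  complement may fix an element of a sub-block; such elements need no separate treatment, since the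
  sum over the block is shown to equal its own negative. The depth bound on \<open>S\<close> gives
  the dominance of the remaining weights.\<close>

lemma inner_coroot: "x \<bullet> coroot a = 2 * (x \<bullet> a) / (a \<bullet> a)"
  by (simp add: coroot_def)

lemma root_reflection_alt: "root_reflection a x = x - (2 * (x \<bullet> a) / (a \<bullet> a)) *\<^sub>R a"
  by (simp add: root_reflection_def inner_coroot)

lemma orthogonal_root_reflection: "orthogonal_transformation (root_reflection a)"
proof -
  have "root_reflection a v \<bullet> root_reflection a w = v \<bullet> w" for v w
    by (cases "a = 0") (auto simp: root_reflection_alt inner_diff_left inner_diff_right
        field_simps inner_commute)
  moreover have "linear (root_reflection a)"
    by (rule linearI) (auto simp: root_reflection_def inner_add_left algebra_simps)
  ultimately show ?thesis by (simp add: orthogonal_transformation_def)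
qed

lemma root_reflection_involution [simp]: "root_reflection a (root_reflection a x) = x"
  by (cases "a = 0") (auto simp: root_reflection_alt inner_diff_left field_simps)

lemma root_reflection_self: "root_reflection a a = - a"
  by (cases "a = 0") (simp_all add: root_reflection_alt scaleR_2)

lemma root_reflection_scaleR: "c \<noteq> 0 \<Longrightarrow> root_reflection (c *\<^sub>R a) = root_reflection a"
  by (auto simp: root_reflection_alt)

lemma root_reflection_minus: "root_reflection (- a) = root_reflection a"
  using root_reflection_scaleR[of "-1" a] by simp

lemma orthogonal_transformation_reflection:
  assumes "orthogonal_transformation f"
  shows "f (root_reflection a x) = root_reflection (f a) (f x)"
proof -
  have "linear f" and "\<And>v w. f v \<bullet> f w = v \<bullet> w"
    using assms by (auto simp: orthogonal_transformation_def)
  then show ?thesis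
    by (simp add: root_reflection_alt linear_diff linear_scale)
qed

lemma det_matrix_comp:
  fixes f g :: "real^'n \<Rightarrow> real^'n"
  assumes "linear f" "linear g"
  shows "det (matrix (f \<circ> g)) = det (matrix f) * det (matrix g)"
  using assms by (simp add: matrix_compose det_mul)

text \<open>Conjugation by an orthogonal map preserves the determinant, and such a map carries the
  direction of \<open>a\<close> to a coordinate axis, where the matrix of the reflection is diagonal
  with a single entry -1.\<close>

lemma det_root_reflection:
  fixes a :: "real^'n"
  assumes "a \<noteq> 0"
  shows "det (matrix (root_reflection a)) = -1"
proof -
  fix k :: 'n
  define e :: "real^'n" where "e = axis k 1"
  have "norm ((1 / norm a) *\<^sub>R a) = 1" "norm e = 1"
    using assms by (auto simp: e_def)
  then obtain f where f: "orthogonal_transformation f" "f ((1 / norm a) *\<^sub>R a) = e"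
    by (rule orthogonal_transformation_exists_1)
  have lin: "linear f" "linear (root_reflection x)" for x :: "real^'n"
    using f orthogonal_root_reflection by (auto simp: orthogonal_transformation_def)
  have "root_reflection ((1 / norm a) *\<^sub>R a) = root_reflection a"
    using assms by (intro root_reflection_scaleR) simp
  then have "f \<circ> root_reflection a = root_reflection e \<circ> f"
    using orthogonal_transformation_reflection[OF f(1), of "(1 / norm a) *\<^sub>R a"] f(2)
    by (auto simp: fun_eq_iff)
  then have "det (matrix f) * det (matrix (root_reflection a)) =
      det (matrix (root_reflection e)) * det (matrix f)"
    using lin by (metis det_matrix_comp)
  moreover have "det (matrix f) \<noteq> 0"
    using f(1) orthogonal_transformation_det by fastforce
  ultimately have eq: "det (matrix (root_reflection a)) = det (matrix (root_reflection e))"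
    by simp
  have ent: "matrix (root_reflection e) $ i $ j =
      (if i = j then (if i = k then -1 else 1) else 0)" for i j
    by (auto simp: matrix_def root_reflection_alt e_def inner_axis_axis axis_eq_axis) (auto simp: axis_def)
  have "det (matrix (root_reflection e)) = (\<Prod>i\<in>UNIV. matrix (root_reflection e) $ i $ i)"
    by (rule det_diagonal) (simp add: ent)
  also have "\<dots> = (\<Prod>i\<in>UNIV. if i = k then -1 else 1)"
    by (simp add: ent)
  also have "\<dots> = -1"
    by (simp add: prod.delta)
  finally show ?thesis using eq by simp
qed

section \<open>Root systems with a basis of simple roots\<close>

text \<open>Lists of indices instead of group elements: the inductions below run over the length of
  a word, reduced or not.\<close>

fun reflection_word :: "('i \<Rightarrow> real^'n) \<Rightarrow> 'i list \<Rightarrow> real^'n \<Rightarrow> real^'n" where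
  "reflection_word \<alpha> [] = id"
| "reflection_word \<alpha> (j # js) = root_reflection (\<alpha> j) \<circ> reflection_word \<alpha> js"

lemma reflection_word_append:
  "reflection_word \<alpha> (js @ ks) = reflection_word \<alpha> js \<circ> reflection_word \<alpha> ks"
  by (induction js) auto

lemma reflection_word_rev: "reflection_word \<alpha> js (reflection_word \<alpha> (rev js) x) = x"
  by (induction js arbitrary: x) (auto simp: reflection_word_append)

definition weyl_sign :: "(real^'n \<Rightarrow> real^'n) \<Rightarrow> int" where
  "weyl_sign w = \<lfloor>det (matrix w)\<rfloor>"

locale root_basis =
  fixes \<Phi> :: "(real^'n) set" and \<alpha> :: "'i \<Rightarrow> real^'n" and J :: "'i set"
  assumes root_system: "root_system \<Phi>" and simple_roots: "simple_roots \<Phi> J \<alpha>"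
begin

abbreviation "W \<equiv> weyl_group \<Phi>"
abbreviation "\<omega> \<equiv> fund_weight \<alpha> J"
abbreviation "\<rho> \<equiv> weyl_vector \<alpha> J"

text \<open>The nonnegative real combinations of simple roots: for \<open>x\<close> in the span the
  coefficient of \<open>\<alpha> j\<close> is \<open>2 * (x \<bullet> \<omega> j) / (\<alpha> j
  \<bullet> \<alpha> j)\<close>, so its sign is that of \<open>x \<bullet> \<omega> j\<close>. The
  positive roots are the roots in \<open>cone\<close>.\<close>

definition cone :: "(real^'n) set" where
  "cone = {x \<in> span (\<alpha> ` J). \<forall>j\<in>J. 0 \<le> x \<bullet> \<omega> j}"

definition dominant :: "real^'n \<Rightarrow> bool" where
  "dominant x \<longleftrightarrow> (\<forall>j\<in>J. 0 \<le> x \<bullet> coroot (\<alpha> j))"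

definition regular :: "real^'n \<Rightarrow> bool" where
  "regular x \<longleftrightarrow> (\<forall>j\<in>J. 0 < x \<bullet> coroot (\<alpha> j))"

lemma finite_J [simp, intro]: "finite J"
  using simple_roots by (auto simp: simple_roots_def)

lemma finite_roots [simp, intro]: "finite \<Phi>"
  using root_system by (auto simp: root_system_def)

lemma root_nonzero: "a \<in> \<Phi> \<Longrightarrow> a \<noteq> 0"
  using root_system by (auto simp: root_system_def)

lemma simple_root: "j \<in> J \<Longrightarrow> \<alpha> j \<in> \<Phi>"
  using simple_roots by (auto simp: simple_roots_def)

lemma simple_root_inner_pos: "j \<in> J \<Longrightarrow> 0 < \<alpha> j \<bullet> \<alpha> j"
  using simple_root root_nonzero by auto

lemma inner_coroot_sign:
  assumes "j \<in> J"
  shows "0 < x \<bullet> coroot (\<alpha> j) \<longleftrightarrow> 0 < x \<bullet> \<alpha> j" "0 \<le> x \<bullet> coroot (\<alpha> j) \<longleftrightarrow> 0 \<le> x \<bullet> \<alpha> j"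
  using simple_root_inner_pos[OF assms]
  by (auto simp: inner_coroot zero_less_divide_iff zero_le_divide_iff simp del: inner_gt_zero_iff)

text \<open>A multiple of the component of \<open>\<alpha> j\<close> orthogonal to the other simple
  roots will do; linear independence makes this component nonzero. Two solutions differ by a vector
  that lies in the span of the simple roots and is orthogonal to all of them.\<close>

lemma fund_weight_ex1:
  assumes j: "j \<in> J"
  shows "\<exists>!w. w \<in> span (\<alpha> ` J) \<and> (\<forall>k\<in>J. w \<bullet> coroot (\<alpha> k) = (if k = j then 1 else 0))"
proof (rule ex_ex1I)
  have inj: "inj_on \<alpha> J" and ind: "independent (\<alpha> ` J)"
    using simple_roots by (auto simp: simple_roots_def)
  obtain p z where pz: "p \<in> span (\<alpha> ` (J - {j}))" "\<And>w. w \<in> span (\<alpha> ` (J - {j})) \<Longrightarrow> orthogonal z w"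
      "\<alpha> j = p + z"
    using orthogonal_subspace_decomp_exists by metis
  have "\<alpha> j \<notin> span (\<alpha> ` (J - {j}))"
    using ind j inj by (auto simp: dependent_def inj_on_image_set_diff[OF inj, of J "{j}"])
  then have "z \<noteq> 0" using pz by auto
  have z\<alpha>: "z \<bullet> \<alpha> k = (if k = j then z \<bullet> z else 0)" if "k \<in> J" for k
  proof (cases "k = j")
    case True
    have "z \<bullet> p = 0" using pz(1,2) by (simp add: orthogonal_def)
    then show ?thesis using True pz(3) by (simp add: inner_add_right)
  next
    case False
    then have "\<alpha> k \<in> span (\<alpha> ` (J - {j}))" using that by (auto intro: span_base)
    then show ?thesis using False pz(2) by (simp add: orthogonal_def)
  qed
  have "p \<in> span (\<alpha> ` J)" using pz(1) span_mono[of "\<alpha> ` (J - {j})" "\<alpha> ` J"] by auto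
  moreover have "\<alpha> j \<in> span (\<alpha> ` J)" using j by (auto intro: span_base)
  ultimately have "z \<in> span (\<alpha> ` J)"
    using pz(3) by (metis add_diff_cancel_left' span_diff)
  then show "\<exists>w. w \<in> span (\<alpha> ` J) \<and> (\<forall>k\<in>J. w \<bullet> coroot (\<alpha> k) = (if k = j then 1 else 0))"
    using z\<alpha> simple_root_inner_pos[OF j] \<open>z \<noteq> 0\<close>
    \<comment> \<open>Since \<open>z \<bullet> \<alpha> j = z \<bullet> z\<close>, this factor makes
      the pairing with \<open>coroot (\<alpha> j)\<close> equal to 1.\<close>
    by (intro exI[of _ "((\<alpha> j \<bullet> \<alpha> j) / (2 * (z \<bullet> z))) *\<^sub>R z"])
       (auto simp: inner_coroot span_scale)
next
  fix v w assume *: "v \<in> span (\<alpha> ` J) \<and> (\<forall>k\<in>J. v \<bullet> coroot (\<alpha> k) = (if k = j then 1 else 0))"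
    "w \<in> span (\<alpha> ` J) \<and> (\<forall>k\<in>J. w \<bullet> coroot (\<alpha> k) = (if k = j then 1 else 0))"
  have o: "orthogonal (v - w) x" if "x \<in> \<alpha> ` J" for x
  proof -
    obtain k where k: "k \<in> J" "x = \<alpha> k" using \<open>x \<in> \<alpha> ` J\<close> by auto
    then have "(v - w) \<bullet> coroot (\<alpha> k) = 0" using * by (simp add: inner_diff_left)
    then show ?thesis using k simple_root_inner_pos by (auto simp: orthogonal_def inner_coroot)
  qed
  have d: "v - w \<in> span (\<alpha> ` J)" by (rule span_diff[OF *[THEN conjunct1]])
  have "orthogonal (v - w) (v - w)" by (rule orthogonal_to_span[OF d o])
  then show "v = w" by (simp add: orthogonal_self)
qed

lemma fund_weight_span: "j \<in> J \<Longrightarrow> \<omega> j \<in> span (\<alpha> ` J)"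
  and fund_weight_coroot: "j \<in> J \<Longrightarrow> k \<in> J \<Longrightarrow> \<omega> j \<bullet> coroot (\<alpha> k) = (if k = j then 1 else 0)"
proof -
  assume j: "j \<in> J"
  note * = theI'[OF fund_weight_ex1[OF j], folded fund_weight_def]
  then show "\<omega> j \<in> span (\<alpha> ` J)" by blast
  show "\<omega> j \<bullet> coroot (\<alpha> k) = (if k = j then 1 else 0)" if "k \<in> J" using * that by blast
qed

lemma fund_weight_simple_root:
  assumes "j \<in> J" "k \<in> J"
  shows "\<alpha> k \<bullet> \<omega> j = (if k = j then (\<alpha> j \<bullet> \<alpha> j) / 2 else 0)"
proof -
  have "2 * (\<omega> j \<bullet> \<alpha> k) / (\<alpha> k \<bullet> \<alpha> k) = (if k = j then 1 else 0)"
    using fund_weight_coroot[OF assms] by (simp only: inner_coroot)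
  then show ?thesis
    using simple_root_inner_pos[OF assms(2)] by (auto simp: inner_commute field_simps split: if_splits)
qed

lemma sum_fund_weight_coroot:
  assumes "k \<in> J"
  shows "(\<Sum>j\<in>J. c j *\<^sub>R \<omega> j) \<bullet> coroot (\<alpha> k) = c k"
proof -
  have "(\<Sum>j\<in>J. c j *\<^sub>R \<omega> j) \<bullet> coroot (\<alpha> k) = (\<Sum>j\<in>J. if j = k then c j else 0)"
    unfolding inner_sum_left by (rule sum.cong) (auto simp: fund_weight_coroot assms)
  then show ?thesis using assms by simp
qed

lemma weyl_vector_coroot: "j \<in> J \<Longrightarrow> \<rho> \<bullet> coroot (\<alpha> j) = 1"
  using sum_fund_weight_coroot[of j "\<lambda>_. 1"] by (simp add: weyl_vector_def)

lemma regular_weyl_vector: "regular \<rho>"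
  by (simp add: regular_def weyl_vector_coroot)

lemma regular_imp_dominant: "regular x \<Longrightarrow> dominant x"
  by (auto simp: regular_def dominant_def less_imp_le)

lemma span_expansion:
  assumes "x \<in> span (\<alpha> ` J)"
  shows "x = (\<Sum>j\<in>J. (2 * (x \<bullet> \<omega> j) / (\<alpha> j \<bullet> \<alpha> j)) *\<^sub>R \<alpha> j)"
proof -
  have inj: "inj_on \<alpha> J" using simple_roots by (auto simp: simple_roots_def)
  obtain u where "x = (\<Sum>v\<in>\<alpha> ` J. u v *\<^sub>R v)"
    using assms span_finite[of "\<alpha> ` J"] by auto
  then have u: "x = (\<Sum>j\<in>J. u (\<alpha> j) *\<^sub>R \<alpha> j)"
    by (simp add: sum.reindex[OF inj])
  have "u (\<alpha> k) = 2 * (x \<bullet> \<omega> k) / (\<alpha> k \<bullet> \<alpha> k)" if "k \<in> J" for k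
  proof -
    have "x \<bullet> \<omega> k = (\<Sum>j\<in>J. if j = k then u (\<alpha> j) * ((\<alpha> k \<bullet> \<alpha> k) / 2) else 0)"
      unfolding u inner_sum_left
      by (rule sum.cong) (use that in \<open>auto simp: fund_weight_simple_root\<close>)
    then show ?thesis using that simple_root_inner_pos[OF that] by (simp add: field_simps)
  qed
  then show ?thesis by (subst u) (rule sum.cong, auto)
qed

lemma span_eqI:
  assumes "x \<in> span (\<alpha> ` J)" "y \<in> span (\<alpha> ` J)" "\<And>j. j \<in> J \<Longrightarrow> x \<bullet> coroot (\<alpha> j) = y \<bullet> coroot (\<alpha> j)"
  shows "x = y"
proof -
  have o: "orthogonal (x - y) z" if "z \<in> \<alpha> ` J" for z
    using that assms(3) simple_root_inner_pos
    by (auto simp: orthogonal_def inner_diff_left inner_coroot)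
  have d: "x - y \<in> span (\<alpha> ` J)" by (rule span_diff[OF assms(1,2)])
  have "orthogonal (x - y) (x - y)" by (rule orthogonal_to_span[OF d o])
  then show ?thesis by (simp add: orthogonal_self)
qed

lemma span_weight_expansion:
  assumes "x \<in> span (\<alpha> ` J)"
  shows "x = (\<Sum>j\<in>J. (x \<bullet> coroot (\<alpha> j)) *\<^sub>R \<omega> j)"
  using assms by (rule span_eqI) (auto intro!: span_sum span_scale fund_weight_span simp: sum_fund_weight_coroot)

section \<open>The cone spanned by the simple roots\<close>

lemma simple_root_cone: "j \<in> J \<Longrightarrow> \<alpha> j \<in> cone"
  using simple_root_inner_pos by (auto simp: cone_def fund_weight_simple_root span_base less_imp_le)

lemma cone_add: "x \<in> cone \<Longrightarrow> y \<in> cone \<Longrightarrow> x + y \<in> cone"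
  by (auto simp: cone_def inner_add_left span_add)

lemma cone_scale: "x \<in> cone \<Longrightarrow> 0 \<le> c \<Longrightarrow> c *\<^sub>R x \<in> cone"
  by (auto simp: cone_def span_scale)

lemma cone_zero: "0 \<in> cone"
  by (auto simp: cone_def span_zero)

lemma cone_sum: "(\<And>i. i \<in> A \<Longrightarrow> f i \<in> cone) \<Longrightarrow> sum f A \<in> cone"
  by (induction A rule: infinite_finite_induct) (auto intro: cone_zero cone_add)

text \<open>Simple coroots and fundamental weights are dual bases. The first factors are nonnegative
  on the cone and the second ones on dominant vectors, which gives the sign statements that
  follow.\<close>

lemma cone_inner_expansion:
  assumes "x \<in> cone"
  shows "x \<bullet> y = (\<Sum>j\<in>J. (x \<bullet> \<omega> j) * (y \<bullet> coroot (\<alpha> j)))"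
proof -
  have "x \<bullet> y = (\<Sum>j\<in>J. (2 * (x \<bullet> \<omega> j) / (\<alpha> j \<bullet> \<alpha> j)) *\<^sub>R \<alpha> j) \<bullet> y"
    using assms span_expansion[of x] by (simp add: cone_def)
  then have "x \<bullet> y = (\<Sum>j\<in>J. (2 * (x \<bullet> \<omega> j) / (\<alpha> j \<bullet> \<alpha> j)) * (\<alpha> j \<bullet> y))"
    by (simp only: inner_sum_left inner_scaleR_left)
  then show ?thesis by (simp add: inner_coroot inner_commute mult_ac)
qed

lemma cone_inner_nonneg: "x \<in> cone \<Longrightarrow> dominant y \<Longrightarrow> 0 \<le> x \<bullet> y"
  by (subst cone_inner_expansion) (auto simp: cone_def dominant_def intro!: sum_nonneg)

lemma cone_inner_zero:
  assumes "x \<in> cone" "regular y" "x \<bullet> y = 0"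
  shows "x = 0"
proof -
  have "\<forall>j\<in>J. (x \<bullet> \<omega> j) * (y \<bullet> coroot (\<alpha> j)) = 0"
    using assms(1,2) cone_inner_expansion[OF assms(1), of y] assms(3)
    by (subst sum_nonneg_eq_0_iff[symmetric]) (auto simp: cone_def regular_def less_imp_le)
  then have "x \<bullet> \<omega> j = 0" if "j \<in> J" for j
    using that assms(2) by (force simp: regular_def)
  then show ?thesis using span_expansion[of x] assms(1) by (simp add: cone_def)
qed

lemma cone_inner_pos:
  assumes "x \<in> cone" "regular y" "x \<noteq> 0"
  shows "0 < x \<bullet> y"
  using cone_inner_nonneg[OF assms(1) regular_imp_dominant[OF assms(2)]] cone_inner_zero[OF assms(1,2)] assms(3)
  by (cases "x \<bullet> y = 0") auto

section \<open>Positive and negative roots\<close>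

lemma root_cone_cases:
  assumes "b \<in> \<Phi>"
  obtains "b \<in> cone" | "- b \<in> cone"
proof -
  obtain c :: "'i \<Rightarrow> nat" where c: "b = (\<Sum>i\<in>J. real (c i) *\<^sub>R \<alpha> i) \<or> b = - (\<Sum>i\<in>J. real (c i) *\<^sub>R \<alpha> i)"
    using simple_roots assms unfolding simple_roots_def by blast
  have "(\<Sum>i\<in>J. real (c i) *\<^sub>R \<alpha> i) \<in> cone"
    by (intro cone_sum cone_scale simple_root_cone) auto
  then show ?thesis using that c by auto
qed

lemma root_span: "b \<in> \<Phi> \<Longrightarrow> b \<in> span (\<alpha> ` J)"
  using span_neg[of "- b" "\<alpha> ` J"] by (elim root_cone_cases) (auto simp: cone_def)

text \<open>Pairing with \<open>\<rho>\<close> separates the two cases: it is positive on nonzero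
  elements of the cone.\<close>

lemma root_not_both:
  assumes "b \<in> \<Phi>" "b \<in> cone"
  shows "- b \<notin> cone"
  using cone_inner_pos[OF assms(2) regular_weyl_vector] root_nonzero[OF assms(1)]
    cone_inner_nonneg[OF _ regular_imp_dominant[OF regular_weyl_vector], of "- b"] by auto

lemma reflection_roots: "a \<in> \<Phi> \<Longrightarrow> b \<in> \<Phi> \<Longrightarrow> root_reflection a b \<in> \<Phi>"
  using root_system by (auto simp: root_system_def)

lemma root_minus: "a \<in> \<Phi> \<Longrightarrow> - a \<in> \<Phi>"
  using reflection_roots[of a a] by (simp add: root_reflection_self)

text \<open>A positive root other than \<open>\<alpha> j\<close> is not a multiple of \<open>\<alpha> j\<close>, so some other coordinate of it
  is positive, and this coordinate survives the reflection.\<close>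

lemma simple_reflection_cone:
  assumes j: "j \<in> J" and b: "b \<in> \<Phi>" "b \<in> cone" "b \<noteq> \<alpha> j"
  shows "root_reflection (\<alpha> j) b \<in> cone"
proof -
  let ?s = "root_reflection (\<alpha> j) b"
  have "\<exists>i\<in>J. i \<noteq> j \<and> b \<bullet> \<omega> i \<noteq> 0"
  proof (rule ccontr)
    assume "\<not> ?thesis"
    then have "b \<bullet> \<omega> i = 0" if "i \<in> J" "i \<noteq> j" for i using that by auto
    then have "(\<Sum>i\<in>J. (2 * (b \<bullet> \<omega> i) / (\<alpha> i \<bullet> \<alpha> i)) *\<^sub>R \<alpha> i) =
        (\<Sum>i\<in>J. if i = j then (2 * (b \<bullet> \<omega> i) / (\<alpha> i \<bullet> \<alpha> i)) *\<^sub>R \<alpha> i else 0)"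
      by (intro sum.cong) auto
    then have "b = (\<Sum>i\<in>J. if i = j then (2 * (b \<bullet> \<omega> i) / (\<alpha> i \<bullet> \<alpha> i)) *\<^sub>R \<alpha> i else 0)"
      using span_expansion[OF root_span[OF b(1)]] by simp
    then obtain c where c: "b = c *\<^sub>R \<alpha> j" using j by auto
    \<comment> \<open>Reducedness of the root system leaves only the two signs.\<close>
    then have "c = 1 \<or> c = -1"
      using root_system simple_root[OF j] b(1) unfolding root_system_def by blast
    then have "b = - \<alpha> j" using c b by auto
    then show False using root_not_both[OF simple_root[OF j] simple_root_cone[OF j]] b by simp
  qed
  then obtain i where i: "i \<in> J" "i \<noteq> j" "b \<bullet> \<omega> i \<noteq> 0" by auto
  then have "0 < b \<bullet> \<omega> i" using b(2) by (auto simp: cone_def order_less_le)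
  moreover have "?s \<bullet> \<omega> i = b \<bullet> \<omega> i"
    using i j by (simp add: root_reflection_def inner_diff_left fund_weight_simple_root)
  ultimately have "- ?s \<notin> cone" using i(1) by (force simp: cone_def)
  moreover have "?s \<in> \<Phi>" using reflection_roots b simple_root j by auto
  ultimately show ?thesis by (blast elim: root_cone_cases)
qed

section \<open>The Weyl group\<close>

lemma weyl_orthogonal: "w \<in> W \<Longrightarrow> orthogonal_transformation w"
proof (induction rule: weyl_group.induct)
  case weyl_id
  then show ?case unfolding id_def by (rule orthogonal_transformation_id)
qed (rule orthogonal_transformation_compose[OF orthogonal_root_reflection])

lemma weyl_linear: "w \<in> W \<Longrightarrow> linear w"
  and weyl_inner: "w \<in> W \<Longrightarrow> w x \<bullet> w y = x \<bullet> y"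
  using weyl_orthogonal by (auto simp: orthogonal_transformation_def)

lemma weyl_norm: "w \<in> W \<Longrightarrow> norm (w x) = norm x"
  by (simp add: norm_eq_sqrt_inner weyl_inner)

lemma weyl_root: "w \<in> W \<Longrightarrow> b \<in> \<Phi> \<Longrightarrow> w b \<in> \<Phi>"
  by (induction rule: weyl_group.induct) (auto intro: reflection_roots)

lemma weyl_comp: "w \<in> W \<Longrightarrow> v \<in> W \<Longrightarrow> w \<circ> v \<in> W"
  by (induction rule: weyl_group.induct) (auto simp: comp_assoc intro: weyl_group.intros)

lemma reflection_weyl: "a \<in> \<Phi> \<Longrightarrow> root_reflection a \<in> W"
  using weyl_step[OF weyl_id, of a] by simp

lemma weyl_inverse: "w \<in> W \<Longrightarrow> \<exists>v\<in>W. w \<circ> v = id \<and> v \<circ> w = id"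
proof (induction rule: weyl_group.induct)
  case weyl_id
  then show ?case by (metis weyl_group.weyl_id comp_id)
next
  case (weyl_step w a)
  then obtain v where "v \<in> W" "\<And>x. w (v x) = x" "\<And>x. v (w x) = x"
    by (auto simp: fun_eq_iff)
  then show ?case using weyl_step
    by (intro bexI[of _ "v \<circ> root_reflection a"]) (auto intro: weyl_comp reflection_weyl)
qed

lemma weyl_inv_into: "w \<in> W \<Longrightarrow> inv w \<in> W"
  and weyl_inv_left: "w \<in> W \<Longrightarrow> inv w (w x) = x"
  and weyl_inv_right: "w \<in> W \<Longrightarrow> w (inv w x) = x"
proof -
  assume "w \<in> W"
  then obtain v where v: "v \<in> W" "w \<circ> v = id" "v \<circ> w = id" using weyl_inverse by blast
  then have "inv w = v" using inv_unique_comp by blast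
  with v show "inv w \<in> W" by simp
  show "inv w (w x) = x" "w (inv w x) = x"
    using v unfolding \<open>inv w = v\<close> by (simp_all add: fun_eq_iff)
qed

text \<open>The roots need not span the ambient space, so the action on their orthogonal complement
  has to be pinned down before an element is known from its action on the roots.\<close>

lemma weyl_fixes_orthogonal:
  assumes "w \<in> W" "\<And>b. b \<in> \<Phi> \<Longrightarrow> x \<bullet> b = 0"
  shows "w x = x"
  using assms(1) by (induction rule: weyl_group.induct) (auto simp: root_reflection_alt assms(2))

lemma finite_weyl [simp, intro]: "finite W"
proof -
  \<comment> \<open>An element of the Weyl group is determined by its action on the roots.\<close>
  have "inj_on (\<lambda>w. restrict w \<Phi>) W"
  proof (rule inj_onI, rule ext)
    fix v w x assume vw: "v \<in> W" "w \<in> W" "restrict v \<Phi> = restrict w \<Phi>"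
    then have eq: "v b = w b" if "b \<in> \<Phi>" for b using that by (metis restrict_apply')
    obtain y z where yz: "y \<in> span \<Phi>" "\<And>w. w \<in> span \<Phi> \<Longrightarrow> orthogonal z w" "x = y + z"
      using orthogonal_subspace_decomp_exists by metis
    have "v y = w y"
      using linear_eq_on_span[of v w \<Phi> y] vw weyl_linear eq yz(1) by auto
    moreover have "v z = z" "w z = z"
      using yz(2) vw by (auto intro!: weyl_fixes_orthogonal simp: orthogonal_def span_base)
    ultimately show "v x = w x"
      using yz(3) vw by (simp add: linear_add weyl_linear)
  qed
  moreover have "(\<lambda>w. restrict w \<Phi>) ` W \<subseteq> PiE \<Phi> (\<lambda>_. \<Phi>)"
    using weyl_root by auto
  ultimately show ?thesis
    by (meson finite_PiE finite_roots finite_imageD finite_subset)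
qed

text \<open>The induction needs the exact integer value of the determinant: the floor respects the
  change of sign only because nothing is rounded.\<close>

lemma weyl_det: "w \<in> W \<Longrightarrow> det (matrix w) = of_int (weyl_sign w) \<and> weyl_sign w * weyl_sign w = 1"
proof (induction rule: weyl_group.induct)
  case weyl_id
  then show ?case by (simp add: weyl_sign_def matrix_id id_def[symmetric] matrix_id_mat_1 det_I)
next
  case (weyl_step w a)
  then have "det (matrix (root_reflection a \<circ> w)) = - det (matrix w)"
    using det_matrix_comp[OF weyl_linear[OF reflection_weyl[of a]] weyl_linear[of w]]
      det_root_reflection[OF root_nonzero[of a]] by simp
  then have "det (matrix (root_reflection a \<circ> w)) = of_int (- weyl_sign w)"
    using weyl_step by simp
  then have "weyl_sign (root_reflection a \<circ> w) = - weyl_sign w"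
    unfolding weyl_sign_def[of "root_reflection a \<circ> w"] by (metis floor_of_int)
  then show ?case
    using weyl_step.IH \<open>det (matrix (root_reflection a \<circ> w)) = of_int (- weyl_sign w)\<close>
    by (simp del: o_apply add: o_def[symmetric])
qed

lemma weyl_sign_square: "w \<in> W \<Longrightarrow> weyl_sign w * weyl_sign w = 1"
  using weyl_det by blast

lemma weyl_sign_comp:
  assumes "v \<in> W" "w \<in> W"
  shows "weyl_sign (v \<circ> w) = weyl_sign v * weyl_sign w"
proof -
  have "real_of_int (weyl_sign (v \<circ> w)) = of_int (weyl_sign v * weyl_sign w)"
    using weyl_det[OF assms(1)] weyl_det[OF assms(2)] weyl_det[OF weyl_comp[OF assms]]
      det_matrix_comp[of v w] weyl_linear assms by simp
  then show ?thesis by linarith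
qed

lemma weyl_sign_id: "weyl_sign id = 1"
  by (simp add: weyl_sign_def matrix_id id_def[symmetric] matrix_id_mat_1 det_I)

lemma weyl_sign_reflection: "a \<in> \<Phi> \<Longrightarrow> weyl_sign (root_reflection a) = -1"
  using det_root_reflection[OF root_nonzero, of a] unfolding weyl_sign_def
  by (metis floor_of_int of_int_1 of_int_minus)

section \<open>Words in simple reflections and the exchange property\<close>

lemma word_weyl: "set js \<subseteq> J \<Longrightarrow> reflection_word \<alpha> js \<in> W"
  by (induction js) (auto intro: weyl_group.intros simple_root)

lemma word_root: "set js \<subseteq> J \<Longrightarrow> b \<in> \<Phi> \<Longrightarrow> reflection_word \<alpha> js b \<in> \<Phi>"
  using word_weyl weyl_root by blast

text \<open>Descent on the height \<open>b \<bullet> \<rho>\<close>. As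
  \<open>b \<bullet> b > 0\<close>, some simple coroot pairs positively with \<open>b\<close>; if
  \<open>b\<close> is not simple, the reflection lowers the height and keeps the root positive.
  Heights are reals, so the induction counts the roots of smaller height.\<close>

lemma positive_root_conjugate_simple:
  assumes "b \<in> \<Phi>" "b \<in> cone"
  shows "\<exists>js j. set js \<subseteq> J \<and> j \<in> J \<and> b = reflection_word \<alpha> js (\<alpha> j)"
  using assms
proof (induction "card {c \<in> \<Phi>. c \<bullet> \<rho> < b \<bullet> \<rho>}" arbitrary: b rule: less_induct)
  case less
  show ?case
  proof (cases "b \<in> \<alpha> ` J")
    case True
    then show ?thesis by (force intro: exI[of _ "[]"])
  next
    case False
    have "b \<bullet> b > 0" using less.prems root_nonzero by auto
    then have "\<not> (\<Sum>j\<in>J. (b \<bullet> \<omega> j) * (b \<bullet> coroot (\<alpha> j))) \<le> 0"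
      using cone_inner_expansion[OF less.prems(2), of b] by simp
    moreover have "0 \<le> b \<bullet> \<omega> j" if "j \<in> J" for j
      using less.prems(2) that by (simp add: cone_def)
    ultimately have "\<exists>j\<in>J. b \<bullet> coroot (\<alpha> j) > 0"
      by (meson sum_nonpos mult_nonneg_nonpos not_less)
    then obtain j where j: "j \<in> J" "b \<bullet> coroot (\<alpha> j) > 0" by auto
    let ?c = "root_reflection (\<alpha> j) b"
    have c: "?c \<in> \<Phi>" "?c \<in> cone"
      using simple_reflection_cone[of j b] j less.prems False reflection_roots simple_root by auto
    have "\<alpha> j \<bullet> \<rho> > 0"
      using weyl_vector_coroot[OF j(1)] inner_coroot_sign(1)[OF j(1), of \<rho>] by (simp add: inner_commute)
    then have lt: "?c \<bullet> \<rho> < b \<bullet> \<rho>"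
      using j by (simp add: root_reflection_def inner_diff_left)
    have "{d \<in> \<Phi>. d \<bullet> \<rho> < ?c \<bullet> \<rho>} \<subset> {d \<in> \<Phi>. d \<bullet> \<rho> < b \<bullet> \<rho>}"
      using lt c by (auto intro: less_trans)
    then have "card {d \<in> \<Phi>. d \<bullet> \<rho> < ?c \<bullet> \<rho>} < card {d \<in> \<Phi>. d \<bullet> \<rho> < b \<bullet> \<rho>}"
      by (intro psubset_card_mono) auto
    from less.hyps[OF this c] obtain js i where i: "set js \<subseteq> J" "i \<in> J" "?c = reflection_word \<alpha> js (\<alpha> i)"
      by auto
    then have "b = reflection_word \<alpha> (j # js) (\<alpha> i)"
      by (metis comp_apply reflection_word.simps(2) root_reflection_involution)
    then show ?thesis using i j by (intro exI[of _ "j # js"] exI[of _ i]) auto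
  qed
qed

text \<open>The reflection in \<open>w (\<alpha> j)\<close> is the conjugate by \<open>w\<close> of
  a simple reflection, and reversing a word inverts it. A negative root has the same reflection as
  its negative.\<close>

lemma reflection_is_word:
  assumes "b \<in> \<Phi>"
  shows "\<exists>js. set js \<subseteq> J \<and> root_reflection b = reflection_word \<alpha> js"
proof -
  have *: ?thesis if "c \<in> \<Phi>" "c \<in> cone" "root_reflection c = root_reflection b" for c
  proof -
    obtain js j where j: "set js \<subseteq> J" "j \<in> J" "c = reflection_word \<alpha> js (\<alpha> j)"
      using positive_root_conjugate_simple \<open>c \<in> \<Phi>\<close> \<open>c \<in> cone\<close> by blast
    have "root_reflection c x = reflection_word \<alpha> (js @ [j] @ rev js) x" for x
      using orthogonal_transformation_reflection[OF weyl_orthogonal[OF word_weyl[OF j(1)]],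
          of "\<alpha> j" "reflection_word \<alpha> (rev js) x"] j(3)
      by (simp add: reflection_word_append reflection_word_rev)
    then show ?thesis using j that
      by (intro exI[of _ "js @ [j] @ rev js"]) (auto simp: fun_eq_iff)
  qed
  from assms show ?thesis
    using *[of b] *[of "- b"] root_minus[of b] root_reflection_minus[of b] root_cone_cases[of b] by metis
qed

lemma weyl_is_word: "w \<in> W \<Longrightarrow> \<exists>js. set js \<subseteq> J \<and> w = reflection_word \<alpha> js"
proof (induction rule: weyl_group.induct)
  case weyl_id
  then show ?case by (intro exI[of _ "[]"]) auto
next
  case (weyl_step w a)
  then obtain js ks where "set js \<subseteq> J" "w = reflection_word \<alpha> js" "set ks \<subseteq> J"
      "root_reflection a = reflection_word \<alpha> ks"
    using reflection_is_word by blast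
  then show ?case by (intro exI[of _ "ks @ js"]) (auto simp: reflection_word_append)
qed

text \<open>Let the letters of \<open>js\<close> act on \<open>\<alpha> i\<close> from the right.
  The root starts positive and ends negative, so some letter \<open>j\<close> turns it from positive
  to negative. A simple reflection does this only to its own root, so the root at that stage is
  \<open>\<alpha> j\<close>, and deleting \<open>j\<close> together with the final \<open>i\<close>
  leaves the product unchanged.\<close>

lemma exchange:
  assumes "set js \<subseteq> J" "i \<in> J" "- reflection_word \<alpha> js (\<alpha> i) \<in> cone"
  shows "\<exists>ks. set ks \<subseteq> J \<and> length ks < length js \<and> reflection_word \<alpha> (js @ [i]) = reflection_word \<alpha> ks"
  using assms
proof (induction js)
  case Nil
  then show ?case using root_not_both[OF simple_root simple_root_cone] by auto
next
  case (Cons j js)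
  let ?b = "reflection_word \<alpha> js (\<alpha> i)"
  have b: "?b \<in> \<Phi>" using Cons.prems word_root simple_root by auto
  from b show ?case
  proof (cases rule: root_cone_cases)
    case 2
    with Cons obtain ks where "set ks \<subseteq> J" "length ks < length js"
        "reflection_word \<alpha> (js @ [i]) = reflection_word \<alpha> ks" by auto
    then show ?thesis using Cons.prems by (intro exI[of _ "j # ks"]) auto
  next
    case 1
    have "- root_reflection (\<alpha> j) ?b \<in> cone" using Cons.prems by simp
    then have "root_reflection (\<alpha> j) ?b \<notin> cone"
      using root_not_both[of "root_reflection (\<alpha> j) ?b"] reflection_roots[OF simple_root b] Cons.prems by auto
    then have "?b = \<alpha> j" using simple_reflection_cone[of j ?b] Cons.prems b 1 by auto
    then have "root_reflection (\<alpha> j) (reflection_word \<alpha> js (root_reflection (\<alpha> i) x)) = reflection_word \<alpha> js x" for x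
      using orthogonal_transformation_reflection[OF weyl_orthogonal[OF word_weyl[of js]], of "\<alpha> i" x] Cons.prems
      by auto
    then show ?thesis using Cons.prems
      by (intro exI[of _ js]) (auto simp: reflection_word_append fun_eq_iff)
  qed
qed

text \<open>If the word ends in \<open>i\<close>, the part before it sends \<open>\<alpha> i\<close>
  to a negative root, so the exchange property yields a shorter word for the same element. Induction
  on the length ends at the empty word.\<close>

lemma word_positive_imp_id:
  assumes "set js \<subseteq> J" "\<And>j. j \<in> J \<Longrightarrow> reflection_word \<alpha> js (\<alpha> j) \<in> cone"
  shows "reflection_word \<alpha> js = id"
  using assms
proof (induction js rule: length_induct)
  case (1 js)
  show ?case
  proof (cases js rule: rev_cases)
    case Nil
    then show ?thesis by simp
  next
    case (snoc ks i)
    with 1 have i: "i \<in> J" "set ks \<subseteq> J" by auto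
    have "reflection_word \<alpha> js (\<alpha> i) = - reflection_word \<alpha> ks (\<alpha> i)"
      using snoc weyl_linear[OF word_weyl[OF i(2)]]
      by (simp add: reflection_word_append root_reflection_self linear_neg)
    then have "- reflection_word \<alpha> ks (\<alpha> i) \<in> cone" using 1 i by metis
    from exchange[OF i(2,1) this] obtain ls where "set ls \<subseteq> J" "length ls < length ks"
        "reflection_word \<alpha> js = reflection_word \<alpha> ls" using snoc by auto
    then show ?thesis using 1 snoc by auto
  qed
qed

text \<open>Splitting off the last letter \<open>i\<close> adds
  \<open>x \<bullet> coroot (\<alpha> i)\<close> times the image of \<open>\<alpha> i\<close> under
  the remaining word. Dominance makes the factor nonnegative; if the image is a negative root, the
  exchange property gives a shorter word for the same element.\<close>

lemma dominant_minus_word_cone: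
  assumes "set js \<subseteq> J" "dominant x"
  shows "x - reflection_word \<alpha> js x \<in> cone"
  using assms(1)
proof (induction js rule: length_induct)
  case (1 js)
  note IH = "1.IH"
  show ?case
  proof (cases js rule: rev_cases)
    case Nil
    then show ?thesis by (simp add: cone_zero)
  next
    case (snoc ks i)
    with 1 have i: "i \<in> J" "set ks \<subseteq> J" by auto
    from word_root[OF i(2) simple_root[OF i(1)]] show ?thesis
    proof (cases rule: root_cone_cases)
      case 2
      from exchange[OF i(2,1) this] obtain ls where "set ls \<subseteq> J" "length ls < length ks"
        "reflection_word \<alpha> js = reflection_word \<alpha> ls" using snoc by auto
      then show ?thesis using IH snoc by auto
    next
      case 1
      have "x - reflection_word \<alpha> js x = (x - reflection_word \<alpha> ks x) +
          (x \<bullet> coroot (\<alpha> i)) *\<^sub>R reflection_word \<alpha> ks (\<alpha> i)"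
        using snoc weyl_linear[OF word_weyl[OF i(2)]]
        by (simp add: reflection_word_append root_reflection_def linear_diff linear_scale)
      moreover have "x - reflection_word \<alpha> ks x \<in> cone" using IH snoc i by auto
      moreover have "0 \<le> x \<bullet> coroot (\<alpha> i)" using assms(2) i by (simp add: dominant_def)
      ultimately show ?thesis using cone_add[OF _ cone_scale[OF 1]] by metis
    qed
  qed
qed

section \<open>The Weyl group on dominant and regular vectors\<close>

lemma dominant_minus_weyl_cone: "w \<in> W \<Longrightarrow> dominant x \<Longrightarrow> x - w x \<in> cone"
  using weyl_is_word dominant_minus_word_cone by blast

text \<open>Invariance of the inner product gives
  \<open>w (\<alpha> j) \<bullet> x = \<alpha> j \<bullet> x > 0\<close>, so \<open>w\<close> keeps
  every simple root positive.\<close>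

lemma weyl_fixes_regular:
  assumes "w \<in> W" "regular x" "w x = x"
  shows "w = id"
proof -
  obtain js where js: "set js \<subseteq> J" "w = reflection_word \<alpha> js" using weyl_is_word assms by blast
  have "reflection_word \<alpha> js (\<alpha> j) \<in> cone" if j: "j \<in> J" for j
  proof -
    have "w (\<alpha> j) \<bullet> x = \<alpha> j \<bullet> x" using weyl_inner[OF assms(1), of "\<alpha> j" x] assms(3) by simp
    also have "\<dots> > 0" using assms(2) j by (auto simp: regular_def inner_coroot_sign inner_commute)
    finally have "- w (\<alpha> j) \<notin> cone"
      using cone_inner_nonneg[OF _ regular_imp_dominant[OF assms(2)], of "- w (\<alpha> j)"] by auto
    then show ?thesis using weyl_root[OF assms(1) simple_root[OF j]] js(2) by (auto elim: root_cone_cases)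
  qed
  then show ?thesis using word_positive_imp_id js by blast
qed

text \<open>Take the point of the orbit with the largest pairing with \<open>\<rho>\<close>: no
  simple reflection can raise this pairing, which forces the pairings with the simple coroots to be
  nonnegative.\<close>

lemma weyl_conjugate_dominant: "\<exists>w\<in>W. dominant (w x)"
proof -
  have "W \<noteq> {}" using weyl_id by auto
  then obtain w where w: "w \<in> W" "\<And>v. v \<in> W \<Longrightarrow> v x \<bullet> \<rho> \<le> w x \<bullet> \<rho>"
    using finite_has_maximal[of "(\<lambda>w. w x \<bullet> \<rho>) ` W"] by (fastforce simp: not_le[symmetric])
  have "0 \<le> w x \<bullet> coroot (\<alpha> j)" if j: "j \<in> J" for j
  proof -
    have "(root_reflection (\<alpha> j) \<circ> w) x \<bullet> \<rho> \<le> w x \<bullet> \<rho>"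
      using w weyl_step[OF w(1) simple_root[OF j]] by blast
    then have "0 \<le> (w x \<bullet> coroot (\<alpha> j)) * (\<alpha> j \<bullet> \<rho>)"
      by (simp add: root_reflection_def inner_diff_left)
    moreover have "\<alpha> j \<bullet> \<rho> > 0"
      using weyl_vector_coroot[OF j] inner_coroot_sign(1)[OF j, of \<rho>] by (simp add: inner_commute)
    ultimately show ?thesis by (simp add: zero_le_mult_iff)
  qed
  then show ?thesis using w by (auto simp: dominant_def)
qed

end

section \<open>Alternants and bialternants\<close>

text \<open>The integers have no 2-torsion. This turns an antisymmetry into a vanishing sum, fixed
  points of the involution included.\<close>

lemma frag_eq_uminus_zero:
  fixes a :: "'a \<Rightarrow>\<^sub>0 int"
  assumes "a = - a"
  shows "a = 0"
proof (rule poly_mapping_eqI)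
  fix k
  have "Poly_Mapping.lookup a k = - Poly_Mapping.lookup a k" 
    using arg_cong[OF assms, of "\<lambda>b. Poly_Mapping.lookup b k"] by simp
  then show "Poly_Mapping.lookup a k = Poly_Mapping.lookup 0 k" by simp
qed

lemma frag_cmul_frag_of: "frag_cmul c (frag_of a) = Poly_Mapping.single a c"
  by (rule poly_mapping_eqI) (simp add: lookup_single when_def)

lemma frag_cmul_single: "frag_cmul c (Poly_Mapping.single a d) = Poly_Mapping.single a (c * d)"
  by (rule poly_mapping_eqI) (simp add: lookup_single when_def)

lemma frag_cmul_mult_right:
  fixes x y :: "('a::monoid_add) \<Rightarrow>\<^sub>0 int"
  shows "x * frag_cmul c y = frag_cmul c (x * y)"
  by (induction c rule: int_induct[where k = 0])
     (simp_all add: frag_cmul_distrib frag_cmul_diff_distrib algebra_simps)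

lemma map_exponents_frag_sum:
  "finite A \<Longrightarrow> map_exponents g (\<Sum>x\<in>A. frag_of (f x)) = (\<Sum>x\<in>A. frag_of (g (f x)))"
  by (simp add: map_exponents_def frag_extend_sum o_def)

lemma lookup_single_mult:
  fixes \<xi> :: "('a::ab_group_add) \<Rightarrow>\<^sub>0 int"
  shows "Poly_Mapping.lookup (Poly_Mapping.single a c * \<xi>) k = c * Poly_Mapping.lookup \<xi> (k - a)"
proof -
  have "\<xi> = (\<Sum>i\<in>Poly_Mapping.keys \<xi>. Poly_Mapping.single i (Poly_Mapping.lookup \<xi> i))"
    using frag_expansion[of \<xi>] by (simp add: frag_extend_def frag_cmul_frag_of)
  then have "Poly_Mapping.single a c * \<xi> =
      (\<Sum>i\<in>Poly_Mapping.keys \<xi>. Poly_Mapping.single (a + i) (c * Poly_Mapping.lookup \<xi> i))"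
    by (metis (no_types, lifting) mult_single sum.cong sum_distrib_left)
  then have "Poly_Mapping.lookup (Poly_Mapping.single a c * \<xi>) k =
      (\<Sum>i\<in>Poly_Mapping.keys \<xi>. if i = k - a then c * Poly_Mapping.lookup \<xi> (k - a) else 0)"
    by (auto simp: lookup_sum lookup_single when_def algebra_simps intro!: sum.cong)
  then show ?thesis by (simp add: in_keys_iff)
qed

context root_basis
begin

lemma alternant_weyl_sign:
  "alternant \<Phi> x = (\<Sum>w\<in>W. Poly_Mapping.single (w x) (weyl_sign w))"
  by (simp add: alternant_def weyl_sign_def frag_cmul_frag_of)

lemma bij_betw_weyl_comp: "v \<in> W \<Longrightarrow> bij_betw (\<lambda>w. w \<circ> v) W W"
  by (rule bij_betw_byWitness[where f' = "\<lambda>w. w \<circ> inv v"])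
     (auto simp: comp_assoc fun_eq_iff weyl_inv_left weyl_inv_right simp del: o_apply
       intro: weyl_comp weyl_inv_into, (simp add: weyl_inv_left weyl_inv_right)+)

text \<open>Right translation by \<open>v\<close> permutes the group and multiplies every sign by
  that of \<open>v\<close>.\<close>

lemma alternant_weyl:
  assumes "v \<in> W"
  shows "alternant \<Phi> (v x) = frag_cmul (weyl_sign v) (alternant \<Phi> x)"
proof -
  have "alternant \<Phi> x = (\<Sum>w\<in>W. Poly_Mapping.single ((w \<circ> v) x) (weyl_sign (w \<circ> v)))"
    unfolding alternant_weyl_sign by (rule sum.reindex_bij_betw[OF bij_betw_weyl_comp[OF assms], symmetric])
  also have "frag_cmul (weyl_sign v) \<dots> = alternant \<Phi> (v x)"
    unfolding alternant_weyl_sign frag_cmul_sum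
  proof (rule sum.cong)
    fix w assume "w \<in> W"
    then have "weyl_sign v * weyl_sign (w \<circ> v) = weyl_sign w"
      using weyl_sign_comp[of w v] weyl_sign_square[OF assms] assms by (simp add: algebra_simps)
    then show "frag_cmul (weyl_sign v) (Poly_Mapping.single ((w \<circ> v) x) (weyl_sign (w \<circ> v))) =
        Poly_Mapping.single (w (v x)) (weyl_sign w)"
      by (simp add: frag_cmul_single)
  qed simp
  finally show ?thesis by simp
qed

lemma alternant_simple_reflection:
  "j \<in> J \<Longrightarrow> alternant \<Phi> (root_reflection (\<alpha> j) x) = - alternant \<Phi> x"
  using alternant_weyl[OF reflection_weyl[OF simple_root]] by (simp add: weyl_sign_reflection simple_root)

lemma alternant_eq_zero:
  assumes "j \<in> J" "x \<bullet> coroot (\<alpha> j) = 0"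
  shows "alternant \<Phi> x = 0"
proof -
  have "root_reflection (\<alpha> j) x = x" using assms by (simp add: root_reflection_def)
  then show ?thesis using alternant_simple_reflection[OF assms(1), of x] by (metis frag_eq_uminus_zero)
qed

text \<open>In the term of \<open>w\<close> the invariant factor may be replaced by its image under
  \<open>w\<close>, so that \<open>w x\<close> meets \<open>w (f y)\<close> and linearity applies.
  The invariant element is given by an indexed family because different vertices may have the same
  weight.\<close>

lemma alternant_mult_invariant:
  assumes "finite A" "\<And>w. w \<in> W \<Longrightarrow> map_exponents w (\<Sum>y\<in>A. frag_of (f y)) = (\<Sum>y\<in>A. frag_of (f y))"
  shows "alternant \<Phi> x * (\<Sum>y\<in>A. frag_of (f y)) = (\<Sum>y\<in>A. alternant \<Phi> (x + f y))"
proof -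
  have "alternant \<Phi> x * (\<Sum>y\<in>A. frag_of (f y)) =
      (\<Sum>w\<in>W. Poly_Mapping.single (w x) (weyl_sign w) * (\<Sum>y\<in>A. frag_of (f y)))"
    by (simp add: alternant_weyl_sign sum_distrib_right)
  also have "\<dots> = (\<Sum>w\<in>W. \<Sum>y\<in>A. Poly_Mapping.single (w (x + f y)) (weyl_sign w))"
  proof (rule sum.cong)
    fix w assume w: "w \<in> W"
    have "(\<Sum>y\<in>A. frag_of (f y)) = (\<Sum>y\<in>A. frag_of (w (f y)))"
      using assms(2)[OF w] map_exponents_frag_sum[OF assms(1)] by metis
    then show "Poly_Mapping.single (w x) (weyl_sign w) * (\<Sum>y\<in>A. frag_of (f y)) =
        (\<Sum>y\<in>A. Poly_Mapping.single (w (x + f y)) (weyl_sign w))"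
      by (simp add: sum_distrib_left mult_single linear_add[OF weyl_linear[OF w]])
  qed simp
  also have "\<dots> = (\<Sum>y\<in>A. alternant \<Phi> (x + f y))"
    unfolding alternant_weyl_sign by (rule sum.swap)
  finally show ?thesis .
qed

section \<open>The lattice of weights\<close>

lemma weights_iff: "x \<in> weights \<alpha> J \<longleftrightarrow> x \<in> span (\<alpha> ` J) \<and> (\<forall>j\<in>J. x \<bullet> coroot (\<alpha> j) \<in> \<int>)"
proof
  assume "x \<in> weights \<alpha> J"
  then show "x \<in> span (\<alpha> ` J) \<and> (\<forall>j\<in>J. x \<bullet> coroot (\<alpha> j) \<in> \<int>)"
    by (auto simp: weights_def sum_fund_weight_coroot intro!: span_sum span_scale fund_weight_span)
next
  assume x: "x \<in> span (\<alpha> ` J) \<and> (\<forall>j\<in>J. x \<bullet> coroot (\<alpha> j) \<in> \<int>)"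
  have "x = (\<Sum>j\<in>J. (x \<bullet> coroot (\<alpha> j)) *\<^sub>R \<omega> j)" using x span_weight_expansion by blast
  also have "\<dots> = (\<Sum>j\<in>J. real_of_int \<lfloor>x \<bullet> coroot (\<alpha> j)\<rfloor> *\<^sub>R \<omega> j)"
    using x by (intro sum.cong) auto
  finally show "x \<in> weights \<alpha> J" unfolding weights_def mem_Collect_eq
    by (intro exI[of _ "\<lambda>j. \<lfloor>x \<bullet> coroot (\<alpha> j)\<rfloor>"]) simp
qed

lemma dominant_weights_iff: "x \<in> dominant_weights \<alpha> J \<longleftrightarrow> x \<in> weights \<alpha> J \<and> dominant x"
proof
  assume "x \<in> dominant_weights \<alpha> J"
  then show "x \<in> weights \<alpha> J \<and> dominant x"
    by (auto simp: dominant_weights_def weights_iff dominant_def sum_fund_weight_coroot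
        intro!: span_sum span_scale fund_weight_span)
next
  assume x: "x \<in> weights \<alpha> J \<and> dominant x"
  then have "x = (\<Sum>j\<in>J. (x \<bullet> coroot (\<alpha> j)) *\<^sub>R \<omega> j)" using span_weight_expansion weights_iff by blast
  also have "\<dots> = (\<Sum>j\<in>J. real (nat \<lfloor>x \<bullet> coroot (\<alpha> j)\<rfloor>) *\<^sub>R \<omega> j)"
    using x by (intro sum.cong) (auto simp: weights_iff dominant_def)
  finally show "x \<in> dominant_weights \<alpha> J" unfolding dominant_weights_def mem_Collect_eq
    by (intro exI[of _ "\<lambda>j. nat \<lfloor>x \<bullet> coroot (\<alpha> j)\<rfloor>"]) simp
qed

lemma weights_add: "x \<in> weights \<alpha> J \<Longrightarrow> y \<in> weights \<alpha> J \<Longrightarrow> x + y \<in> weights \<alpha> J"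
  and weights_diff: "x \<in> weights \<alpha> J \<Longrightarrow> y \<in> weights \<alpha> J \<Longrightarrow> x - y \<in> weights \<alpha> J"
  by (auto simp: weights_iff inner_add_left inner_diff_left span_add span_diff)

lemma weyl_vector_weight: "\<rho> \<in> weights \<alpha> J"
  by (auto simp: weights_iff weyl_vector_coroot weyl_vector_def intro!: span_sum fund_weight_span)
     (auto simp: weyl_vector_coroot simp flip: weyl_vector_def)

lemma weights_simple_reflection:
  assumes "j \<in> J" "x \<in> weights \<alpha> J"
  shows "root_reflection (\<alpha> j) x \<in> weights \<alpha> J"
proof -
  have "\<alpha> j \<bullet> coroot (\<alpha> k) \<in> \<int>" if "k \<in> J" for k
    using root_system simple_root assms(1) that unfolding root_system_def by blast
  moreover have "\<alpha> j \<in> span (\<alpha> ` J)" using assms(1) by (auto intro: span_base)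
  ultimately show ?thesis using assms
    by (auto simp: weights_iff root_reflection_def inner_diff_left intro: span_diff span_scale)
qed

lemma weights_weyl:
  assumes "w \<in> W" "x \<in> weights \<alpha> J"
  shows "w x \<in> weights \<alpha> J"
proof -
  have "reflection_word \<alpha> js x \<in> weights \<alpha> J" if "set js \<subseteq> J" for js
    using that by (induction js) (auto intro: assms(2) weights_simple_reflection)
  then show ?thesis using weyl_is_word[OF assms(1)] by blast
qed

text \<open>The coordinates of a weight are integers, bounded by Cauchy-Schwarz. This is what makes
  an induction on the norm of weights well-founded.\<close>

lemma finite_weights_bounded: "finite {x \<in> weights \<alpha> J. norm x \<le> C}"
proof -
  let ?f = "\<lambda>x. restrict (\<lambda>j. \<lfloor>x \<bullet> coroot (\<alpha> j)\<rfloor>) J"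
  let ?K = "\<lambda>j. \<lceil>C * norm (coroot (\<alpha> j))\<rceil>"
  have "inj_on ?f (weights \<alpha> J)"
  proof (rule inj_onI)
    fix x y assume xy: "x \<in> weights \<alpha> J" "y \<in> weights \<alpha> J" "?f x = ?f y"
    have "x \<bullet> coroot (\<alpha> j) = y \<bullet> coroot (\<alpha> j)" if "j \<in> J" for j
    proof -
      have "\<lfloor>x \<bullet> coroot (\<alpha> j)\<rfloor> = \<lfloor>y \<bullet> coroot (\<alpha> j)\<rfloor>"
        using fun_cong[OF xy(3), of j] that by simp
      moreover have "x \<bullet> coroot (\<alpha> j) \<in> \<int>" "y \<bullet> coroot (\<alpha> j) \<in> \<int>"
        using xy that by (auto simp: weights_iff)
      ultimately show ?thesis by (metis of_int_floor)
    qed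
    then show "x = y" using span_eqI xy by (auto simp: weights_iff)
  qed
  then have "inj_on ?f {x \<in> weights \<alpha> J. norm x \<le> C}"
    by (rule inj_on_subset) auto
  moreover have "?f ` {x \<in> weights \<alpha> J. norm x \<le> C} \<subseteq> PiE J (\<lambda>j. {- ?K j .. ?K j})"
  proof (intro image_subsetI PiE_I)
    fix x j assume x: "x \<in> {x \<in> weights \<alpha> J. norm x \<le> C}" and "j \<in> J"
    have "\<bar>x \<bullet> coroot (\<alpha> j)\<bar> \<le> norm x * norm (coroot (\<alpha> j))" by (rule Cauchy_Schwarz_ineq2)
    also have "\<dots> \<le> C * norm (coroot (\<alpha> j))" using x by (intro mult_right_mono) auto
    finally have "\<lfloor>x \<bullet> coroot (\<alpha> j)\<rfloor> \<in> {- ?K j .. ?K j}" by (simp, linarith)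
    then show "?f x j \<in> {- ?K j .. ?K j}" using \<open>j \<in> J\<close> by simp
  qed auto
  ultimately show ?thesis
    by (meson finite_J finite_PiE finite_atLeastAtMost_int finite_imageD finite_subset)
qed

section \<open>Divisibility by the Weyl denominator and cancellation\<close>

lemma orbit_sum_invariant:
  assumes "v \<in> W"
  shows "map_exponents v (\<Sum>y\<in>(\<lambda>w. w x) ` W. frag_of y) = (\<Sum>y\<in>(\<lambda>w. w x) ` W. frag_of y)"
proof -
  have "v ` (\<lambda>w. w x) ` W \<subseteq> (\<lambda>w. w x) ` W"
    using weyl_comp[OF assms] by (auto simp: image_iff) (metis o_apply)
  moreover have "inj_on v ((\<lambda>w. w x) ` W)"
    by (metis assms inj_onI weyl_inv_left)
  ultimately have "bij_betw v ((\<lambda>w. w x) ` W) ((\<lambda>w. w x) ` W)"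
    by (simp add: bij_betw_def endo_inj_surj)
  from sum.reindex_bij_betw[OF this, of frag_of] show ?thesis
    by (simp add: map_exponents_frag_sum[of _ _ "\<lambda>y. y", simplified])
qed

text \<open>As \<open>w x\<close> and \<open>x\<close> have equal norm, comparing squared norms
  reduces to \<open>0 < (x - w x) \<bullet> y\<close>, a nonzero element of the cone paired with a
  regular vector.\<close>

lemma norm_add_weyl_less:
  assumes "w \<in> W" "dominant x" "w x \<noteq> x" "regular y"
  shows "norm (y + w x) < norm (y + x)"
proof -
  have "0 < (x - w x) \<bullet> y"
    using cone_inner_pos[OF dominant_minus_weyl_cone[OF assms(1,2)] assms(4)] assms(3) by simp
  moreover have "w x \<bullet> w x = x \<bullet> x" using weyl_inner assms(1) by blast
  moreover have "y \<bullet> w x = w x \<bullet> y" "y \<bullet> x = x \<bullet> y" by (simp_all add: inner_commute)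
  ultimately have "(y + w x) \<bullet> (y + w x) < (y + x) \<bullet> (y + x)"
    by (simp add: inner_add_left inner_add_right inner_diff_left)
  then show ?thesis by (simp add: norm_eq_sqrt_inner)
qed

text \<open>The product of \<open>alternant \<Phi> \<rho>\<close> and the orbit sum of a dominant weight \<open>\<lambda>\<close> is
  \<open>alternant \<Phi> (\<lambda> + \<rho>)\<close> plus alternants of weights of smaller norm, so divisibility follows by
  induction on the norm.\<close>

lemma weyl_denominator_dvd_alternant:
  assumes "x \<in> weights \<alpha> J"
  shows "\<exists>\<xi>. Poly_Mapping.keys \<xi> \<subseteq> weights \<alpha> J \<and> alternant \<Phi> \<rho> * \<xi> = alternant \<Phi> x"
  using assms
\<comment> \<open>Norms are reals, so the induction counts the weights of smaller norm.\<close>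
proof (induction "card {y \<in> weights \<alpha> J. norm y < norm x}" arbitrary: x rule: less_induct)
  case less
  obtain w where w: "w \<in> W" "dominant (w x)" using weyl_conjugate_dominant by blast
  let ?z = "w x"
  have z: "?z \<in> weights \<alpha> J" "norm ?z = norm x"
    using weights_weyl weyl_norm w less.prems by auto
  have Ax: "alternant \<Phi> x = frag_cmul (weyl_sign w) (alternant \<Phi> ?z)"
    using alternant_weyl[OF w(1), of x] weyl_sign_square[OF w(1)] by simp
  have "\<exists>\<eta>. Poly_Mapping.keys \<eta> \<subseteq> weights \<alpha> J \<and> alternant \<Phi> \<rho> * \<eta> = alternant \<Phi> ?z"
  proof (cases "regular ?z")
    \<comment> \<open>A dominant vector that is not regular lies on a wall, where the alternant
      vanishes.\<close>
    case False
    then obtain j where "j \<in> J" "?z \<bullet> coroot (\<alpha> j) = 0"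
      using w(2) by (force simp: regular_def dominant_def)
    then have "alternant \<Phi> ?z = 0" by (rule alternant_eq_zero)
    then show ?thesis by (intro exI[of _ 0]) auto
  next
    case True
    define l where "l = ?z - \<rho>"
    have l: "l \<in> weights \<alpha> J" "dominant l"
    proof -
      show "l \<in> weights \<alpha> J" using z weyl_vector_weight by (auto simp: l_def intro: weights_diff)
      have "0 \<le> l \<bullet> coroot (\<alpha> j)" if "j \<in> J" for j
      proof -
        have "?z \<bullet> coroot (\<alpha> j) \<in> \<int>" "0 < ?z \<bullet> coroot (\<alpha> j)"
          using True z that by (auto simp: regular_def weights_iff)
        \<comment> \<open>A positive integer is at least 1, which is what subtracting
          \<open>\<rho>\<close> takes from every coordinate.\<close>
        then have "1 \<le> ?z \<bullet> coroot (\<alpha> j)" by (auto elim: Ints_cases)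
        then show ?thesis using that by (simp add: l_def inner_diff_left weyl_vector_coroot)
      qed
      then show "dominant l" by (simp add: dominant_def)
    qed
    let ?O = "(\<lambda>w. w l) ` W"
    let ?m = "\<Sum>y\<in>?O. frag_of y"
    have "l \<in> ?O" using imageI[OF weyl_id, of "\<lambda>w. w l" \<Phi>] by simp
    have "\<exists>\<xi>. Poly_Mapping.keys \<xi> \<subseteq> weights \<alpha> J \<and> alternant \<Phi> \<rho> * \<xi> = alternant \<Phi> (\<rho> + y)"
      if "y \<in> ?O - {l}" for y
    proof (rule less.hyps)
      obtain u where u: "u \<in> W" "y = u l" "u l \<noteq> l" using \<open>y \<in> ?O - {l}\<close> by auto
      show y: "\<rho> + y \<in> weights \<alpha> J"
        using u l weyl_vector_weight weights_weyl weights_add by auto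
      have lt: "norm (\<rho> + y) < norm x"
        using norm_add_weyl_less[OF u(1) l(2) u(3) regular_weyl_vector] u(2) z(2) by (simp add: l_def)
      have "finite {y \<in> weights \<alpha> J. norm y < norm x}"
        by (rule finite_subset[OF _ finite_weights_bounded[of "norm x"]]) auto
      moreover have "{z \<in> weights \<alpha> J. norm z < norm (\<rho> + y)} \<subset> {y \<in> weights \<alpha> J. norm y < norm x}"
        using lt y by (auto intro: less_trans)
      ultimately show "card {z \<in> weights \<alpha> J. norm z < norm (\<rho> + y)} < card {y \<in> weights \<alpha> J. norm y < norm x}"
        by (rule psubset_card_mono)
    qed
    then obtain \<xi> where \<xi>: "\<And>y. y \<in> ?O - {l} \<Longrightarrow> Poly_Mapping.keys (\<xi> y) \<subseteq> weights \<alpha> J"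
        "\<And>y. y \<in> ?O - {l} \<Longrightarrow> alternant \<Phi> \<rho> * \<xi> y = alternant \<Phi> (\<rho> + y)"
      by metis
    let ?\<eta> = "?m - (\<Sum>y\<in>?O - {l}. \<xi> y)"
    have "alternant \<Phi> \<rho> * ?m = (\<Sum>y\<in>?O. alternant \<Phi> (\<rho> + y))"
      by (rule alternant_mult_invariant) (auto intro: orbit_sum_invariant)
    also have "\<dots> = alternant \<Phi> ?z + (\<Sum>y\<in>?O - {l}. alternant \<Phi> (\<rho> + y))"
      using \<open>l \<in> ?O\<close> by (subst sum.remove[of _ l]) (auto simp: l_def)
    finally have "alternant \<Phi> \<rho> * ?\<eta> = alternant \<Phi> ?z"
      using \<xi>(2) by (simp add: right_diff_distrib sum_distrib_left)
    moreover have "Poly_Mapping.keys ?\<eta> \<subseteq> weights \<alpha> J"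
    proof -
      have "Poly_Mapping.keys ?m \<subseteq> weights \<alpha> J"
        using keys_sum[of frag_of ?O] weights_weyl l by force
      moreover have "Poly_Mapping.keys (\<Sum>y\<in>?O - {l}. \<xi> y) \<subseteq> weights \<alpha> J"
        using keys_sum[of \<xi> "?O - {l}"] \<xi>(1) by blast
      ultimately show ?thesis using keys_diff[of ?m "\<Sum>y\<in>?O - {l}. \<xi> y"] by blast
    qed
    ultimately show ?thesis by blast
  qed
  then obtain \<eta> where \<eta>: "Poly_Mapping.keys \<eta> \<subseteq> weights \<alpha> J" "alternant \<Phi> \<rho> * \<eta> = alternant \<Phi> ?z"
    by blast
  show ?case
    using \<eta> Ax keys_cmul[of "weyl_sign w" \<eta>]
    by (intro exI[of _ "frag_cmul (weyl_sign w) \<eta>"]) (auto simp: frag_cmul_mult_right)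
qed

text \<open>Among the exponents of \<open>\<xi>\<close> pick \<open>\<mu>\<close> with the largest inner product with \<open>\<rho>\<close>; the coefficient
  of the product at \<open>\<rho> + \<mu>\<close> is that of \<open>\<xi>\<close> at \<open>\<mu>\<close>.\<close>

lemma weyl_denominator_mult_eq_zero:
  assumes "alternant \<Phi> \<rho> * \<xi> = 0"
  shows "\<xi> = 0"
proof (rule ccontr)
  assume "\<xi> \<noteq> 0"
  then have "Poly_Mapping.keys \<xi> \<noteq> {}" by simp
  then obtain \<mu> where \<mu>: "\<mu> \<in> Poly_Mapping.keys \<xi>" "\<And>y. y \<in> Poly_Mapping.keys \<xi> \<Longrightarrow> y \<bullet> \<rho> \<le> \<mu> \<bullet> \<rho>"
    using finite_has_maximal[of "(\<lambda>y. y \<bullet> \<rho>) ` Poly_Mapping.keys \<xi>"] by (fastforce simp: not_le[symmetric])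
  have "Poly_Mapping.lookup (alternant \<Phi> \<rho> * \<xi>) (\<rho> + \<mu>) = (\<Sum>w\<in>W. weyl_sign w * Poly_Mapping.lookup \<xi> (\<rho> + \<mu> - w \<rho>))"
    by (simp add: alternant_weyl_sign sum_distrib_right lookup_sum lookup_single_mult)
  also have "\<dots> = (\<Sum>w\<in>W. if w = id then Poly_Mapping.lookup \<xi> \<mu> else 0)"
  proof (rule sum.cong)
    fix w assume w: "w \<in> W"
    show "weyl_sign w * Poly_Mapping.lookup \<xi> (\<rho> + \<mu> - w \<rho>) = (if w = id then Poly_Mapping.lookup \<xi> \<mu> else 0)"
    proof (cases "w = id")
      case True
      then show ?thesis by (simp add: weyl_sign_id)
    next
      case False
      then have "w \<rho> \<noteq> \<rho>" using weyl_fixes_regular[OF w regular_weyl_vector] by auto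
      then have "0 < (\<rho> - w \<rho>) \<bullet> \<rho>"
        using cone_inner_pos[OF dominant_minus_weyl_cone[OF w regular_imp_dominant[OF regular_weyl_vector]] regular_weyl_vector]
        by simp
      \<comment> \<open>The pairing of this exponent with \<open>\<rho>\<close> exceeds the maximum
        over the exponents of \<open>\<xi>\<close>, so the coefficient there is 0.\<close>
      then have "\<not> (\<rho> + \<mu> - w \<rho>) \<bullet> \<rho> \<le> \<mu> \<bullet> \<rho>" by (simp add: inner_diff_left inner_add_left)
      then have "Poly_Mapping.lookup \<xi> (\<rho> + \<mu> - w \<rho>) = 0" using \<mu>(2) in_keys_iff by metis
      then show ?thesis using False by simp
    qed
  qed simp
  also have "\<dots> = Poly_Mapping.lookup \<xi> \<mu>" by (simp add: weyl_id)
  finally show False using assms \<mu>(1) by (simp add: in_keys_iff)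
qed

lemma weyl_denominator_cancel:
  assumes "alternant \<Phi> \<rho> * \<xi> = alternant \<Phi> \<rho> * \<eta>"
  shows "\<xi> = \<eta>"
  using weyl_denominator_mult_eq_zero[of "\<xi> - \<eta>"] assms by (simp add: right_diff_distrib)

text \<open>Divisibility gives existence and cancellation gives uniqueness for the definite
  description. \<open>\<Psi>\<close> is the full root system that \<open>bialternant\<close> refers
  to, \<open>\<Phi>\<close> its subsystem attached to \<open>J\<close>.\<close>

lemma weyl_denominator_mult_bialternant:
  assumes "root_subsystem \<Psi> \<alpha> J = \<Phi>" "x \<in> weights \<alpha> J"
  shows "alternant \<Phi> \<rho> * bialternant \<Psi> \<alpha> J x = alternant \<Phi> (x + \<rho>)"
proof -
  have "\<exists>!\<xi>. Poly_Mapping.keys \<xi> \<subseteq> weights \<alpha> J \<and> alternant \<Phi> \<rho> * \<xi> = alternant \<Phi> (x + \<rho>)"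
    using weyl_denominator_dvd_alternant[of "x + \<rho>"] weyl_denominator_cancel assms(2)
      weyl_vector_weight weights_add by metis
  from theI'[OF this] show ?thesis by (simp add: bialternant_def assms(1))
qed

end

section \<open>Components of a colored ranked poset\<close>

lemma rank_function_cong:
  assumes "rank_function A r \<rho> l" "\<And>y. y \<in> A \<Longrightarrow> \<rho>' y = \<rho> y" "r \<subseteq> A \<times> A"
  shows "rank_function A r \<rho>' l"
proof -
  have "\<rho>' ` A = {0..l}" using assms(1,2) by (simp add: rank_function_def)
  moreover have "\<rho>' s + 1 = \<rho>' t" if "covered_by r s t" for s t
  proof -
    have "s \<in> A" "t \<in> A" using that assms(3) by (auto simp: covered_by_def)
    then show ?thesis using assms(1,2) that by (auto simp: rank_function_def)
  qed
  ultimately show ?thesis by (simp add: rank_function_def)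
qed

locale colored_poset =
  fixes I :: "'i set" and R :: "'p set" and r :: "'p rel" and col :: "'p \<Rightarrow> 'p \<Rightarrow> 'i"
  assumes colored_ranked: "colored_ranked_poset I R r col"
begin

abbreviation "compt \<equiv> component r col"
abbreviation "comp_ord \<equiv> component_order r col"
abbreviation "edges \<equiv> color_edges r col"
abbreviation "rk \<equiv> comp_rank r col"
abbreviation "len \<equiv> comp_length r col"

lemma finite_R [simp, intro]: "finite R"
  using colored_ranked by (simp add: colored_ranked_poset_def)

lemma edge_in_R: "(s, t) \<in> edges j \<Longrightarrow> s \<in> R \<and> t \<in> R"
  using colored_ranked
  by (auto simp: colored_ranked_poset_def color_edges_def covered_by_def partial_order_on_def
      preorder_on_def)

lemma component_refl [simp, intro]: "x \<in> compt j x"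
  by (simp add: component_def)

lemma component_eq: "y \<in> compt j x \<Longrightarrow> compt j y = compt j x"
proof -
  let ?E = "(edges j \<union> (edges j)\<inverse>)\<^sup>*"
  have "sym ?E" by (intro sym_rtrancl sym_Un_converse)
  moreover assume "y \<in> compt j x"
  ultimately have "(x, y) \<in> ?E" "(y, x) \<in> ?E" by (auto simp: component_def sym_def)
  then show ?thesis unfolding component_def by (auto intro: rtrancl_trans)
qed

lemma component_order_eq: "y \<in> compt j x \<Longrightarrow> comp_ord j y = comp_ord j x"
  by (simp add: component_order_def component_eq)

lemma component_edge:
  assumes "(s, t) \<in> edges j"
  shows "s \<in> compt j x \<longleftrightarrow> t \<in> compt j x"
proof -
  have "t \<in> compt j s" using assms by (auto simp: component_def)
  then have "compt j t = compt j s" by (rule component_eq)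
  then show ?thesis using component_eq by (metis component_refl)
qed

lemma component_induct [consumes 1, case_names base up down]:
  assumes "y \<in> compt j x" "P x"
    "\<And>s t. s \<in> compt j x \<Longrightarrow> t \<in> compt j x \<Longrightarrow> (s, t) \<in> edges j \<Longrightarrow> P s \<Longrightarrow> P t"
    "\<And>s t. s \<in> compt j x \<Longrightarrow> t \<in> compt j x \<Longrightarrow> (s, t) \<in> edges j \<Longrightarrow> P t \<Longrightarrow> P s"
  shows "P y"
proof -
  have "(x, y) \<in> (edges j \<union> (edges j)\<inverse>)\<^sup>*" using assms(1) by (simp add: component_def)
  then have "y \<in> compt j x \<and> P y"
  proof (induction rule: rtrancl_induct)
    case base
    then show ?case using assms(2) by simp
  next
    case (step y z)
    then show ?case using assms(3,4) component_edge by (metis Un_iff converseD)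
  qed
  then show ?thesis ..
qed

lemma component_subset: "x \<in> R \<Longrightarrow> compt j x \<subseteq> R"
proof
  fix y assume "x \<in> R" "y \<in> compt j x"
  from this(2,1) show "y \<in> R" by (induction rule: component_induct) (auto dest: edge_in_R)
qed

lemma finite_component: "x \<in> R \<Longrightarrow> finite (compt j x)"
  using component_subset finite_subset by blast

lemma global_rank: obtains g :: "'p \<Rightarrow> nat" where "\<And>s t j. (s, t) \<in> edges j \<Longrightarrow> g t = g s + 1"
proof -
  obtain g l where "rank_function R r g l"
    using colored_ranked by (auto simp: colored_ranked_poset_def)
  then have "\<And>s t j. (s, t) \<in> edges j \<Longrightarrow> g t = g s + 1"
    by (auto simp: rank_function_def color_edges_def)
  then show ?thesis by (rule that)
qed

text \<open>The order is a reflexive transitive closure, so covers have to be traced back to edges.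
  A global rank that rises by 1 along each edge shows that nothing fits between the ends of an edge;
  conversely, the first edge of a path between a covering pair already reaches the top.\<close>

lemma covered_by_component_order:
  "covered_by (comp_ord j x) s t \<longleftrightarrow> (s, t) \<in> edges j \<and> s \<in> compt j x \<and> t \<in> compt j x"
proof -
  obtain g :: "'p \<Rightarrow> nat" where g: "\<And>s t. (s, t) \<in> edges j \<Longrightarrow> g t = g s + 1"
    using global_rank by metis
  have mono: "g a \<le> g b \<and> (g a = g b \<longrightarrow> a = b)" if "(a, b) \<in> (edges j)\<^sup>*" for a b
    using that
  proof (induction rule: rtrancl_induct)
    case (step y z)
    then show ?case using g[of y z] by auto
  qed auto
  show ?thesis
  proof
    assume c: "covered_by (comp_ord j x) s t"
    then have st: "(s, t) \<in> (edges j)\<^sup>*" "s \<noteq> t" "s \<in> compt j x" "t \<in> compt j x"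
      by (auto simp: covered_by_def component_order_def)
    then obtain u where u: "(s, u) \<in> edges j" "(u, t) \<in> (edges j)\<^sup>*"
      by (metis converse_rtranclE)
    have "u \<in> compt j x" using component_edge u(1) st(3) by blast
    then have "u = s \<or> u = t"
      using c u st by (auto simp: covered_by_def component_order_def)
    moreover have "u \<noteq> s" using g[OF u(1)] by auto
    ultimately show "(s, t) \<in> edges j \<and> s \<in> compt j x \<and> t \<in> compt j x" using u st by auto
  next
    assume st: "(s, t) \<in> edges j \<and> s \<in> compt j x \<and> t \<in> compt j x"
    have "u = s \<or> u = t" if "(s, u) \<in> (edges j)\<^sup>*" "(u, t) \<in> (edges j)\<^sup>*" for u
    proof -
      have "g t = g s + 1" using st g by blast
      then show ?thesis using mono[OF that(1)] mono[OF that(2)]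
        by (metis Suc_eq_plus1 le_Suc_eq le_antisym)
    qed
    moreover have "s \<noteq> t" using st g[of s t] by auto
    ultimately show "covered_by (comp_ord j x) s t"
      using st by (auto simp: covered_by_def component_order_def)
  qed
qed

lemma component_order_subset: "comp_ord j x \<subseteq> compt j x \<times> compt j x"
  by (auto simp: component_order_def)

text \<open>Restrict a rank function of the whole poset to the component and subtract its minimum
  there. The values fill an interval because each step along an edge changes the rank by 1.\<close>

lemma component_rank_function_exists:
  assumes x: "x \<in> R"
  shows "\<exists>\<rho> l. rank_function (compt j x) (comp_ord j x) \<rho> l"
proof -
  obtain g :: "'p \<Rightarrow> nat" where g: "\<And>s t. (s, t) \<in> edges j \<Longrightarrow> g t = g s + 1"
    using global_rank by metis
  let ?C = "compt j x"
  have fin: "finite (g ` ?C)" and ne: "g ` ?C \<noteq> {}"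
    using finite_component x component_refl by auto
  obtain a where a: "a \<in> ?C" "g a = Min (g ` ?C)" using Min_in[OF fin ne] by auto
  obtain b where b: "b \<in> ?C" "g b = Max (g ` ?C)" using Max_in[OF fin ne] by auto
  have interval: "\<forall>k. g a \<le> k \<longrightarrow> k \<le> g y \<longrightarrow> k \<in> g ` ?C" if "y \<in> compt j a" for y
    using that
  proof (induction rule: component_induct)
    case base
    show ?case using a(1) by (auto dest: le_antisym)
  next
    case (up s t)
    then have "g t \<in> g ` ?C" using component_eq[OF a(1)] by simp
    then show ?case using up(4) g[OF up(3)] by (auto simp: le_Suc_eq)
  next
    case (down s t)
    then show ?case using g[OF down(3)] by auto
  qed
  have "(\<lambda>y. g y - g a) ` ?C = {0..g b - g a}"
  proof
    show "(\<lambda>y. g y - g a) ` ?C \<subseteq> {0..g b - g a}"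
      using fin b(2) by (auto intro!: diff_le_mono)
    show "{0..g b - g a} \<subseteq> (\<lambda>y. g y - g a) ` ?C"
    proof
      fix k assume "k \<in> {0..g b - g a}"
      moreover have "g a \<le> g b" using a(1) b(2) fin by simp
      ultimately have "g a + k \<in> g ` ?C" using interval[of b] b(1) component_eq[OF a(1)] by auto
      then obtain y where "y \<in> ?C" "g y = g a + k" by auto
      then show "k \<in> (\<lambda>y. g y - g a) ` ?C" by (auto simp: image_iff intro!: bexI[of _ y])
    qed
  qed
  moreover have "(g s - g a) + 1 = g t - g a" if "covered_by (comp_ord j x) s t" for s t
  proof -
    have "(s, t) \<in> edges j" "s \<in> ?C" using that by (auto simp: covered_by_component_order)
    moreover have "g a \<le> g s" using a(2) fin \<open>s \<in> ?C\<close> by simp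
    ultimately show ?thesis using g[of s t] by simp
  qed
  ultimately have "rank_function ?C (comp_ord j x) (\<lambda>y. g y - g a) (g b - g a)"
    by (simp add: rank_function_def)
  then show ?thesis by blast
qed

text \<open>The difference of two rank functions does not change along edges, hence is constant on
  the component. Both functions attain 0, so the constant is 0.\<close>

lemma component_rank_function_unique:
  assumes 1: "rank_function (compt j x) (comp_ord j x) \<rho>1 l1"
    and 2: "rank_function (compt j x) (comp_ord j x) \<rho>2 l2"
  shows "l1 = l2" "y \<in> compt j x \<Longrightarrow> \<rho>1 y = \<rho>2 y"
proof -
  have const: "int (\<rho>1 y) - int (\<rho>2 y) = int (\<rho>1 x) - int (\<rho>2 x)" if "y \<in> compt j x" for y
    using that
  proof (induction rule: component_induct)
    case (up s t)
    then have "covered_by (comp_ord j x) s t" by (simp add: covered_by_component_order)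
    then have "\<rho>1 s + 1 = \<rho>1 t" "\<rho>2 s + 1 = \<rho>2 t" using 1 2 by (auto simp: rank_function_def)
    then show ?case using up by linarith
  next
    case (down s t)
    then have "covered_by (comp_ord j x) s t" by (simp add: covered_by_component_order)
    then have "\<rho>1 s + 1 = \<rho>1 t" "\<rho>2 s + 1 = \<rho>2 t" using 1 2 by (auto simp: rank_function_def)
    then show ?case using down by linarith
  qed simp
  have im: "\<rho>1 ` compt j x = {0..l1}" "\<rho>2 ` compt j x = {0..l2}"
    using 1 2 by (auto simp: rank_function_def)
  then have "0 \<in> \<rho>1 ` compt j x" "0 \<in> \<rho>2 ` compt j x" by simp_all
  then obtain y1 y2 where "y1 \<in> compt j x" "\<rho>1 y1 = 0" "y2 \<in> compt j x" "\<rho>2 y2 = 0"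
    by (metis imageE)
  then have "int (\<rho>1 x) = int (\<rho>2 x)" using const[of y1] const[of y2] by linarith
  then have eq: "\<rho>1 y = \<rho>2 y" if "y \<in> compt j x" for y using const[OF that] by linarith
  then show "y \<in> compt j x \<Longrightarrow> \<rho>1 y = \<rho>2 y" .
  have "{0..l1} = {0..l2}" using eq im by (metis image_cong)
  then show "l1 = l2" by simp
qed

lemma comp_rank_eq:
  assumes "rank_function (compt j x) (comp_ord j x) \<rho> l" "y \<in> compt j x"
  shows "rk j y = \<rho> y" "len j y = l"
proof -
  have "poset_rank (compt j x) (comp_ord j x) y = \<rho> y"
    unfolding poset_rank_def using assms component_rank_function_unique(2) by (intro the_equality) blast+
  then show "rk j y = \<rho> y"
    using assms(2) by (simp add: comp_rank_def component_eq component_order_eq)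
  have "poset_length (compt j x) (comp_ord j x) = l"
    unfolding poset_length_def using assms component_rank_function_unique(1) by (intro the_equality) blast+
  then show "len j y = l"
    using assms(2) by (simp add: comp_length_def component_eq component_order_eq)
qed

lemma comp_length_eq: "y \<in> compt j x \<Longrightarrow> len j y = len j x"
  by (simp add: comp_length_def component_eq component_order_eq)

lemma rank_function_comp_rank:
  assumes "x \<in> R"
  shows "rank_function (compt j x) (comp_ord j x) (rk j) (len j x)"
proof -
  obtain \<rho> l where \<rho>: "rank_function (compt j x) (comp_ord j x) \<rho> l"
    using component_rank_function_exists assms by blast
  then have "len j x = l" using comp_rank_eq(2) by blast
  then show ?thesis
    using rank_function_cong[OF \<rho> _ component_order_subset] comp_rank_eq(1)[OF \<rho>] by simp
qed

lemma comp_rank_le: "x \<in> R \<Longrightarrow> rk j x \<le> len j x"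
  using rank_function_comp_rank[of x j] component_refl[of x j] by (auto simp: rank_function_def)

lemma comp_rank_edge:
  assumes "(s, t) \<in> edges j"
  shows "rk j t = rk j s + 1"
proof -
  have "covered_by (comp_ord j s) s t"
    using assms component_edge[OF assms, of s] by (simp add: covered_by_component_order)
  then show ?thesis
    using rank_function_comp_rank[of s j] edge_in_R[OF assms] by (simp add: rank_function_def)
qed

end

section \<open>Products of chains\<close>

lemma chain_product_sum_le: "xs \<in> chain_product ns \<Longrightarrow> sum_list xs \<le> sum_list ns"
  by (auto simp: chain_product_def intro: sum_list_mono2)

lemma chain_product_sum_attained: "k \<le> sum_list ns \<Longrightarrow> \<exists>xs\<in>chain_product ns. sum_list xs = k"
proof (induction ns arbitrary: k)
  case Nil
  then show ?case by (auto simp: chain_product_def)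
next
  case (Cons n ns)
  have "k - min k n \<le> sum_list ns" using Cons.prems by auto
  then obtain xs where "xs \<in> chain_product ns" "sum_list xs = k - min k n" using Cons.IH by blast
  then show ?case
    by (intro bexI[of _ "min k n # xs"]) (auto simp: chain_product_def nth_Cons split: nat.splits)
qed

text \<open>Raising by 1 a coordinate in which the two elements differ gives an element between
  them, so in a cover it is the upper one.\<close>

lemma rank_function_chain_product:
  "rank_function (chain_product ns) (chain_product_order ns) sum_list (sum_list ns)"
proof -
  have "sum_list ` chain_product ns = {0..sum_list ns}"
    using chain_product_sum_le chain_product_sum_attained by (fastforce simp: image_iff)
  moreover have "sum_list xs + 1 = sum_list ys" if c: "covered_by (chain_product_order ns) xs ys" for xs ys
  proof -
    have xy: "length xs = length ns" "length ys = length ns" "xs \<noteq> ys"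
        "\<forall>q<length ns. xs ! q \<le> ys ! q" "\<forall>q<length ns. ys ! q \<le> ns ! q"
      using c by (auto simp: covered_by_def chain_product_order_def chain_product_def)
    then obtain q where q: "q < length ns" "xs ! q < ys ! q"
      by (metis nth_equalityI order_le_less)
    let ?zs = "xs[q := Suc (xs ! q)]"
    have "(xs, ?zs) \<in> chain_product_order ns" "(?zs, ys) \<in> chain_product_order ns"
      using xy q by (auto simp: chain_product_order_def chain_product_def nth_list_update intro: le_trans)
    moreover have "?zs \<noteq> xs" using q xy by (metis n_not_Suc_n nth_list_update_eq)
    ultimately have "ys = ?zs" using c by (auto simp: covered_by_def)
    then show ?thesis using q xy by (simp add: sum_list_update)
  qed
  ultimately show ?thesis by (simp add: rank_function_def)
qed

lemma rank_function_poset_iso: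
  assumes iso: "poset_iso A r B r' \<phi>" and "r \<subseteq> A \<times> A" "r' \<subseteq> B \<times> B" "rank_function A r \<rho> l"
  shows "rank_function B r' (\<rho> \<circ> inv_into A \<phi>) l"
proof -
  let ?\<psi> = "inv_into A \<phi>"
  have bij: "bij_betw \<phi> A B" and ord: "\<And>x y. x \<in> A \<Longrightarrow> y \<in> A \<Longrightarrow> (x, y) \<in> r \<longleftrightarrow> (\<phi> x, \<phi> y) \<in> r'"
    using iso by (auto simp: poset_iso_def)
  have \<psi>: "bij_betw ?\<psi> B A" using bij by (rule bij_betw_inv_into)
  have inv: "\<And>x. x \<in> A \<Longrightarrow> ?\<psi> (\<phi> x) = x" "\<And>y. y \<in> B \<Longrightarrow> \<phi> (?\<psi> y) = y" "\<And>y. y \<in> B \<Longrightarrow> ?\<psi> y \<in> A"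
    "\<And>x. x \<in> A \<Longrightarrow> \<phi> x \<in> B"
    using bij \<psi> by (auto simp: bij_betw_inv_into_left bij_betw_inv_into_right bij_betwE)
  have "(\<rho> \<circ> ?\<psi>) ` B = {0..l}"
    using \<psi> assms(4) by (metis bij_betw_def image_comp rank_function_def)
  moreover have "\<rho> (?\<psi> s) + 1 = \<rho> (?\<psi> t)" if c: "covered_by r' s t" for s t
  proof -
    have st: "s \<in> B" "t \<in> B" using c assms(3) by (auto simp: covered_by_def)
    have "covered_by r (?\<psi> s) (?\<psi> t)"
      unfolding covered_by_def
    proof (intro conjI allI impI)
      show "(?\<psi> s, ?\<psi> t) \<in> r" "?\<psi> s \<noteq> ?\<psi> t"
        using c st ord inv by (auto simp: covered_by_def) metis
      fix u assume u: "(?\<psi> s, u) \<in> r \<and> (u, ?\<psi> t) \<in> r"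
      then have "u \<in> A" using assms(2) by auto
      then have "\<phi> u = s \<or> \<phi> u = t" using u c st ord inv by (metis covered_by_def)
      then show "u = ?\<psi> s \<or> u = ?\<psi> t" using inv \<open>u \<in> A\<close> by auto
    qed
    then show ?thesis using assms(4) by (simp add: rank_function_def)
  qed
  ultimately show ?thesis by (simp add: rank_function_def)
qed

lemma sum_list_complement:
  assumes "xs \<in> chain_product ms"
  shows "map2 (-) ms xs \<in> chain_product ms" "map2 (-) ms (map2 (-) ms xs) = xs"
    "sum_list xs + sum_list (map2 (-) ms xs) = sum_list ms"
proof -
  have l: "length xs = length ms" "\<And>q. q < length ms \<Longrightarrow> xs ! q \<le> ms ! q"
    using assms by (auto simp: chain_product_def)
  show "map2 (-) ms xs \<in> chain_product ms" using l by (auto simp: chain_product_def)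
  show "map2 (-) ms (map2 (-) ms xs) = xs" using l by (intro nth_equalityI) auto
  have "sum_list xs + sum_list (map2 (-) ms xs) = (\<Sum>q<length ms. xs ! q + (ms ! q - xs ! q))"
    using l(1) by (simp add: sum_list_sum_nth sum.distrib atLeast0LessThan)
  also have "\<dots> = (\<Sum>q<length ms. ms ! q)" using l(2) by (intro sum.cong) auto
  finally show "sum_list xs + sum_list (map2 (-) ms xs) = sum_list ms"
    by (simp add: sum_list_sum_nth atLeast0LessThan)
qed

text \<open>The coordinates before \<open>q\<close> are free, the one at \<open>q\<close> is capped
  and those after it are 0, so the sub-block is a product of shortened chains. The lengths removed
  add up to \<open>b\<close>.\<close>

lemma sub_block_eq_chain_product:
  assumes "b > 0" "sub_block ns b \<noteq> {}"
  shows "\<exists>ms. sub_block ns b = chain_product ms \<and> sum_list ms + b = sum_list ns"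
proof -
  let ?T = "\<lambda>q. \<Sum>k\<in>{q<..<length ns}. ns ! k"
  have T: "(\<Sum>k\<in>{q..<length ns}. ns ! k) = ns ! q + ?T q" if "q < length ns" for q
    using that by (simp add: sum.atLeast_Suc_lessThan atLeastSucLessThan_greaterThanLessThan)
  from assms(2) obtain q where q: "q < length ns" "?T q < b" "b \<le> ns ! q + ?T q"
    by (auto simp: sub_block_def T)
  \<comment> \<open>For different positions the admissible ranges of \<open>b\<close> are disjoint,
    because the tail sum at an earlier position contains the whole chain at a later one.\<close>
  have uniq: "q' = q" if "q' < length ns" "?T q' < b" "b \<le> ns ! q' + ?T q'" for q'
  proof -
    have *: False if "i < k" "k < length ns" "?T i < b" "b \<le> ns ! k + ?T k" for i k
    proof -
      have "(\<Sum>k\<in>{k..<length ns}. ns ! k) \<le> ?T i"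
        using that by (intro sum_mono2) auto
      then show False using that T[of k] by simp
    qed
    show ?thesis using *[of q q'] *[of q' q] that q by (cases q q' rule: linorder_cases) auto
  qed
  \<comment> \<open>What remains of \<open>b\<close> once the chains after \<open>q\<close> are
    collapsed to a point; it is taken off the top of the chain at \<open>q\<close>.\<close>
  define b' where "b' = b - ?T q"
  define ms where "ms = map (\<lambda>k. if k < q then ns ! k else if k = q then ns ! q - b' else 0) [0..<length ns]"
  have b': "b = b' + ?T q" "b' \<le> ns ! q" using q by (auto simp: b'_def)
  have nth: "ms ! k = (if k < q then ns ! k else if k = q then ns ! q - b' else 0)" if "k < length ns" for k
    using that by (simp add: ms_def)
  have len: "length ms = length ns" by (simp add: ms_def)
  have "xs \<in> sub_block ns b \<longleftrightarrow> xs \<in> chain_product ms" for xs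
  proof
    assume "xs \<in> sub_block ns b"
    then obtain q' where xs: "xs \<in> chain_product ns" and q': "q' < length ns" "?T q' < b" "b \<le> ns ! q' + ?T q'"
       "\<forall>k\<in>{q'<..<length ns}. xs ! k = 0" "ns ! q' - xs ! q' \<ge> b - ?T q'"
      by (auto simp: sub_block_def T)
    have "q' = q" using uniq q' by blast
    then have "xs ! k \<le> ms ! k" if "k < length ns" for k
      using that q' xs nth[OF that] b'_def
      by (cases k q rule: linorder_cases) (auto simp: chain_product_def)
    then show "xs \<in> chain_product ms" using xs len by (auto simp: chain_product_def)
  next
    assume "xs \<in> chain_product ms"
    then have xs: "length xs = length ns" "\<And>k. k < length ns \<Longrightarrow> xs ! k \<le> ms ! k"
      using len by (auto simp: chain_product_def)
    have "xs \<in> chain_product ns"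
      unfolding chain_product_def
    proof (intro CollectI conjI allI impI xs(1))
      fix k assume "k < length ns"
      then show "xs ! k \<le> ns ! k"
        using xs(2)[of k] nth[of k] by (auto split: if_splits intro: le_trans)
    qed
    moreover have "\<forall>k\<in>{q<..<length ns}. xs ! k = 0" using xs(2) nth by fastforce
    moreover have "ns ! q - xs ! q \<ge> b - ?T q"
      using xs(2)[OF q(1)] nth[OF q(1)] b' by simp
    ultimately show "xs \<in> sub_block ns b" using q T[OF q(1)] by (auto simp: sub_block_def)
  qed
  moreover have "sum_list ms + b = sum_list ns"
  proof -
    have split: "{..<length ns} = {..<q} \<union> {q} \<union> {q<..<length ns}" using q by auto
    have *: "(\<Sum>k<length ns. f k) = (\<Sum>k<q. f k) + f q + (\<Sum>k\<in>{q<..<length ns}. f k)" for f :: "nat \<Rightarrow> nat"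
      unfolding split by (subst sum.union_disjoint; auto)+
    have "(\<Sum>k<length ns. ms ! k) = (\<Sum>k<q. ns ! k) + (ns ! q - b')"
      unfolding * using nth q(1) by simp
    then show ?thesis
      using b' *[of "(!) ns"] by (simp add: sum_list_sum_nth atLeast0LessThan len)
  qed
  ultimately show ?thesis by blast
qed

context colored_poset
begin

lemma comp_rank_chain_product:
  assumes "poset_iso (chain_product ns) (chain_product_order ns) (compt j x) (comp_ord j x) \<phi>"
  shows "xs \<in> chain_product ns \<Longrightarrow> rk j (\<phi> xs) = sum_list xs" "len j x = sum_list ns"
proof -
  have rf: "rank_function (compt j x) (comp_ord j x) (sum_list \<circ> inv_into (chain_product ns) \<phi>) (sum_list ns)"
    by (rule rank_function_poset_iso[OF assms _ component_order_subset rank_function_chain_product])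
       (auto simp: chain_product_order_def)
  show "len j x = sum_list ns" using comp_rank_eq(2)[OF rf] by blast
  assume xs: "xs \<in> chain_product ns"
  have bij: "bij_betw \<phi> (chain_product ns) (compt j x)" using assms by (simp add: poset_iso_def)
  then have "\<phi> xs \<in> compt j x" using xs by (auto simp: bij_betw_def)
  from comp_rank_eq(1)[OF rf this] show "rk j (\<phi> xs) = sum_list xs"
    using bij xs by (simp add: bij_betw_inv_into_left)
qed

text \<open>A sub-block is itself a product of chains, and complementation in it sends rank \<open>k\<close> to
  rank \<open>l - b - k\<close>.\<close>

lemma sub_block_sum_eq_zero:
  fixes F :: "'p \<Rightarrow> 'b \<Rightarrow>\<^sub>0 int"
  assumes K: "is_sub_block (compt j x) (comp_ord j x) b K" and "b > 0"
    and F: "\<And>y z. y \<in> compt j x \<Longrightarrow> z \<in> compt j x \<Longrightarrow> rk j y + rk j z + b = len j x \<Longrightarrow> F z = - F y"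
  shows "(\<Sum>y\<in>K. F y) = - (\<Sum>y\<in>K. F y)"
proof -
  obtain ns \<phi> where "K \<subseteq> compt j x"
    and iso: "poset_iso (chain_product ns) (chain_product_order ns) (compt j x) (comp_ord j x) \<phi>"
    and sb: "{xs \<in> chain_product ns. \<phi> xs \<in> K} = sub_block ns b"
    using K by (auto simp: is_sub_block_def)
  have bij: "bij_betw \<phi> (chain_product ns) (compt j x)" using iso by (simp add: poset_iso_def)
  then have "K = \<phi> ` sub_block ns b" using \<open>K \<subseteq> compt j x\<close> sb by (force simp: bij_betw_def)
  moreover have "inj_on \<phi> (sub_block ns b)"
    using bij sb by (auto simp: bij_betw_def intro: inj_on_subset)
  ultimately have sumK: "(\<Sum>y\<in>K. F y) = (\<Sum>xs\<in>sub_block ns b. F (\<phi> xs))"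
    by (simp add: sum.reindex)
  show ?thesis
  proof (cases "sub_block ns b = {}")
    case True
    then show ?thesis using sumK by simp
  next
    case False
    then obtain ms where ms: "sub_block ns b = chain_product ms" "sum_list ms + b = sum_list ns"
      using sub_block_eq_chain_product \<open>b > 0\<close> by blast
    let ?c = "map2 (-) ms"
    have "(\<Sum>xs\<in>chain_product ms. F (\<phi> xs)) = (\<Sum>xs\<in>chain_product ms. F (\<phi> (?c xs)))"
      by (rule sum.reindex_bij_witness[of _ ?c ?c]) (auto simp: sum_list_complement)
    also have "\<dots> = (\<Sum>xs\<in>chain_product ms. - F (\<phi> xs))"
    proof (rule sum.cong)
      fix xs assume xs: "xs \<in> chain_product ms"
      then have in_ns: "xs \<in> chain_product ns" "?c xs \<in> chain_product ns"
        using sum_list_complement(1) ms(1) sb by blast+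
      then have "\<phi> xs \<in> compt j x" "\<phi> (?c xs) \<in> compt j x" using bij by (auto simp: bij_betw_def)
      \<comment> \<open>The two ranks add up to \<open>sum_list ms\<close>, which falls short of the
        length of the component by \<open>b\<close>.\<close>
      moreover have "rk j (\<phi> xs) + rk j (\<phi> (?c xs)) + b = len j x"
        using comp_rank_chain_product[OF iso] in_ns sum_list_complement(3)[OF xs] ms(2) by simp
      ultimately show "F (\<phi> (?c xs)) = - F (\<phi> xs)" by (rule F)
    qed simp
    finally show ?thesis using sumK ms(1) by (simp add: sum_negf)
  qed
qed

section \<open>Sums over kindred sets and over components\<close>

lemma kindred_eq: "y \<in> kindred R r col S \<kappa> x \<Longrightarrow> kindred R r col S \<kappa> y = kindred R r col S \<kappa> x"
  by (auto simp: kindred_def component_eq)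

text \<open>The kindred sets partition \<open>R - S\<close>: each vertex lies in its own, and two
  that meet coincide.\<close>

lemma sum_over_kindred:
  assumes "\<And>x. x \<in> R - S \<Longrightarrow> (\<Sum>y\<in>kindred R r col S \<kappa> x. F y) = 0"
  shows "(\<Sum>x\<in>R - S. F x) = 0"
proof -
  let ?k = "kindred R r col S \<kappa>"
  have "(\<Sum>x\<in>R - S. F x) = (\<Sum>K\<in>?k ` (R - S). \<Sum>x\<in>{x \<in> R - S. ?k x = K}. F x)"
    by (rule sum.image_gen) auto
  also have "\<dots> = (\<Sum>K\<in>?k ` (R - S). 0)"
  proof (rule sum.cong)
    fix K assume "K \<in> ?k ` (R - S)"
    then obtain x where x: "x \<in> R - S" "K = ?k x" by auto
    have "{y \<in> R - S. ?k y = K} = K"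
    proof (intro equalityI subsetI)
      fix y assume "y \<in> {y \<in> R - S. ?k y = K}"
      moreover from this have "y \<in> ?k y" by (auto simp: kindred_def)
      ultimately show "y \<in> K" by auto
    next
      fix y assume "y \<in> K"
      then show "y \<in> {y \<in> R - S. ?k y = K}" using kindred_eq x(2) by (auto simp: kindred_def)
    qed
    then show "(\<Sum>x\<in>{x \<in> R - S. ?k x = K}. F x) = 0" using assms x by simp
  qed simp
  finally show ?thesis by simp
qed

lemma sum_over_components:
  assumes "\<And>x. x \<in> R \<Longrightarrow> (\<Sum>y\<in>compt j x. F y) = (\<Sum>y\<in>compt j x. G y)"
  shows "(\<Sum>x\<in>R. F x) = (\<Sum>x\<in>R. G x)"
proof -
  have *: "(\<Sum>x\<in>R. H x) = (\<Sum>C\<in>compt j ` R. \<Sum>x\<in>C. H x)" for H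
  proof -
    have "(\<Sum>x\<in>R. H x) = (\<Sum>C\<in>compt j ` R. \<Sum>x\<in>{x \<in> R. compt j x = C}. H x)"
      by (rule sum.image_gen) auto
    also have "\<dots> = (\<Sum>C\<in>compt j ` R. \<Sum>x\<in>C. H x)"
    proof (rule sum.cong)
      fix C assume "C \<in> compt j ` R"
      then obtain x where x: "x \<in> R" "C = compt j x" by auto
      have "{y \<in> R. compt j y = C} = C"
      proof (intro equalityI subsetI)
        fix y assume "y \<in> {y \<in> R. compt j y = C}"
        then show "y \<in> C" using component_refl[of y j] by simp
      next
        fix y assume "y \<in> C"
        then show "y \<in> {y \<in> R. compt j y = C}"
          using x(2) component_subset[OF x(1), of j] component_eq[of y j x] by auto
      qed
      then show "(\<Sum>x\<in>{x \<in> R. compt j x = C}. H x) = (\<Sum>x\<in>C. H x)" by simp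
    qed simp
    finally show ?thesis .
  qed
  have "(\<Sum>C\<in>compt j ` R. \<Sum>x\<in>C. F x) = (\<Sum>C\<in>compt j ` R. \<Sum>x\<in>C. G x)"
    by (rule sum.cong[OF refl]) (use assms in auto)
  then show ?thesis using *[of F] *[of G] by simp
qed

text \<open>A sum of values depending on the rank alone sees only the sizes of the ranks. The rank
  function that witnesses the symmetry agrees with \<open>rk\<close> on the component by
  uniqueness.\<close>

lemma sum_rank_symmetric:
  fixes h :: "nat \<Rightarrow> 'c::comm_semiring_1"
  assumes x: "x \<in> R" and sym: "rank_symmetric (compt j x) (comp_ord j x)"
  shows "(\<Sum>y\<in>compt j x. h (len j x - rk j y)) = (\<Sum>y\<in>compt j x. h (rk j y))"
proof -
  let ?C = "compt j x" and ?l = "len j x"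
  let ?n = "\<lambda>k. card {y \<in> ?C. rk j y = k}"
  obtain \<rho> l where \<rho>: "rank_function ?C (comp_ord j x) \<rho> l"
      "\<forall>i\<le>l. card {y\<in>?C. \<rho> y = i} = card {y\<in>?C. \<rho> y = l - i}"
    using sym by (auto simp: rank_symmetric_def)
  have "l = ?l" using comp_rank_eq(2)[OF \<rho>(1), of x] by simp
  moreover have "{y\<in>?C. \<rho> y = i} = {y\<in>?C. rk j y = i}" for i
    by (intro Collect_cong conj_cong refl) (simp only: comp_rank_eq(1)[OF \<rho>(1)])
  ultimately have n: "?n k = ?n (?l - k)" if "k \<le> ?l" for k
    using \<rho>(2)[rule_format, of k] that by metis
  have im: "rk j ` ?C \<subseteq> {..?l}"
    using rank_function_comp_rank[OF x, of j] by (auto simp: rank_function_def)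
  have *: "(\<Sum>y\<in>?C. f (rk j y)) = (\<Sum>k\<le>?l. of_nat (?n k) * f k)" for f :: "nat \<Rightarrow> 'c"
  proof -
    have "(\<Sum>y\<in>?C. f (rk j y)) = (\<Sum>k\<le>?l. \<Sum>y\<in>{y \<in> ?C. rk j y = k}. f (rk j y))"
      by (rule sum.group[symmetric]) (use im finite_component[OF x] in auto)
    also have "\<dots> = (\<Sum>k\<le>?l. of_nat (?n k) * f k)"
      by (intro sum.cong) auto
    finally show ?thesis .
  qed
  have "(\<Sum>y\<in>?C. h (?l - rk j y)) = (\<Sum>k\<le>?l. of_nat (?n k) * h (?l - k))" by (rule *)
  also have "\<dots> = (\<Sum>k\<le>?l. of_nat (?n (?l - k)) * h k)"
    by (rule sum.reindex_bij_witness[of _ "\<lambda>k. ?l - k" "\<lambda>k. ?l - k"]) auto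
  also have "\<dots> = (\<Sum>k\<le>?l. of_nat (?n k) * h k)"
    by (intro sum.cong refl) (simp only: n[symmetric] atMost_iff)
  also have "\<dots> = (\<Sum>y\<in>?C. h (rk j y))" by (rule *[symmetric])
  finally show ?thesis .
qed

end

section \<open>Root subsystems\<close>

text \<open>A root in the span of the simple roots from \<open>J\<close> is orthogonal to
  \<open>\<omega> k\<close> for \<open>k\<close> outside \<open>J\<close>. This pairing reads off
  the coefficient of \<open>\<alpha> k\<close>, so the expansion over \<open>I\<close> is already
  one over \<open>J\<close>.\<close>

lemma root_basis_subsystem:
  assumes "root_basis \<Phi> \<alpha> I" "J \<subseteq> I"
  shows "root_basis (root_subsystem \<Phi> \<alpha> J) \<alpha> J"
proof
  interpret root_basis \<Phi> \<alpha> I by fact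
  have ref: "root_reflection a b \<in> root_subsystem \<Phi> \<alpha> J"
    if "a \<in> root_subsystem \<Phi> \<alpha> J" "b \<in> root_subsystem \<Phi> \<alpha> J" for a b
    using that reflection_roots
    by (auto simp: root_subsystem_def root_reflection_def intro!: span_diff span_scale)
  have "root_reflection a ` root_subsystem \<Phi> \<alpha> J = root_subsystem \<Phi> \<alpha> J"
    if "a \<in> root_subsystem \<Phi> \<alpha> J" for a
    using ref[OF that] by (auto simp: image_iff) (metis root_reflection_involution)
  then show "root_system (root_subsystem \<Phi> \<alpha> J)"
    using root_system by (auto simp: root_system_def root_subsystem_def)
  have "\<exists>c :: 'b \<Rightarrow> nat. b = (\<Sum>i\<in>J. real (c i) *\<^sub>R \<alpha> i) \<or> b = - (\<Sum>i\<in>J. real (c i) *\<^sub>R \<alpha> i)"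
    if b: "b \<in> root_subsystem \<Phi> \<alpha> J" for b
  proof -
    \<comment> \<open>Carrying the sign as a factor \<open>e\<close> treats positive and negative
      roots at once.\<close>
    obtain c :: "'b \<Rightarrow> nat" and e :: real where e: "e = 1 \<or> e = -1"
      and c: "b = e *\<^sub>R (\<Sum>i\<in>I. real (c i) *\<^sub>R \<alpha> i)"
    proof -
      have "b \<in> \<Phi>" using b by (simp add: root_subsystem_def)
      then obtain c :: "'b \<Rightarrow> nat" where
        "b = (\<Sum>i\<in>I. real (c i) *\<^sub>R \<alpha> i) \<or> b = - (\<Sum>i\<in>I. real (c i) *\<^sub>R \<alpha> i)"
        using simple_roots unfolding simple_roots_def by blast
      then show ?thesis using that[of 1 c] that[of "-1" c] by auto
    qed
    have "c k = 0" if k: "k \<in> I - J" for k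
    proof -
      have "orthogonal (\<omega> k) b"
      proof (rule orthogonal_to_span)
        show "b \<in> span (\<alpha> ` J)" using b by (simp add: root_subsystem_def)
        show "orthogonal (\<omega> k) y" if "y \<in> \<alpha> ` J" for y
          using that k assms(2) by (auto simp: orthogonal_def inner_commute fund_weight_simple_root subset_iff)
      qed
      then have "0 = (\<Sum>i\<in>I. real (c i) *\<^sub>R \<alpha> i) \<bullet> \<omega> k"
        using c e by (auto simp: orthogonal_def inner_commute)
      also have "\<dots> = (\<Sum>i\<in>I. if i = k then real (c k) * ((\<alpha> k \<bullet> \<alpha> k) / 2) else 0)"
        unfolding inner_sum_left by (rule sum.cong) (use k in \<open>auto simp: fund_weight_simple_root\<close>)
      also have "\<dots> = real (c k) * ((\<alpha> k \<bullet> \<alpha> k) / 2)" using k by simp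
      finally show ?thesis using simple_root_inner_pos[of k] k by simp
    qed
    then have "(\<Sum>i\<in>I. real (c i) *\<^sub>R \<alpha> i) = (\<Sum>i\<in>J. real (c i) *\<^sub>R \<alpha> i)"
      using assms(2) by (intro sum.mono_neutral_right) auto
    then show ?thesis using c e by (intro exI[of _ c]) auto
  qed
  moreover have "inj_on \<alpha> J" "independent (\<alpha> ` J)" "finite J"
    using simple_roots inj_on_subset[OF _ assms(2)] independent_mono[OF _ image_mono[OF assms(2)]]
      finite_subset[OF assms(2)]
    unfolding simple_roots_def by blast+
  moreover have "\<alpha> ` J \<subseteq> root_subsystem \<Phi> \<alpha> J"
    using simple_root assms(2) by (auto simp: root_subsystem_def span_base)
  ultimately show "simple_roots (root_subsystem \<Phi> \<alpha> J) J \<alpha>"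
    by (simp add: simple_roots_def)
qed

section \<open>Splitting\<close>

text \<open>Here \<open>\<Phi>\<close> is the subsystem attached to \<open>J\<close>, with
  \<open>J\<close> as its full set of simple root indices; \<open>I\<close> remains as the set of
  edge colors.\<close>

locale structured_poset = root_basis \<Phi> \<alpha> J + colored_poset I R r col
  for \<Phi> :: "(real^'n) set" and \<alpha> :: "'i \<Rightarrow> real^'n" and J I :: "'i set"
    and R :: "'p set" and r :: "'p rel" and col :: "'p \<Rightarrow> 'p \<Rightarrow> 'i" +
  assumes structured: "structured \<alpha> J r col"
begin

abbreviation "wtJ \<equiv> wt \<alpha> J r col"

lemma wt_coroot: "j \<in> J \<Longrightarrow> wtJ x \<bullet> coroot (\<alpha> j) = 2 * real (rk j x) - real (len j x)"
  by (simp add: wt_def sum_fund_weight_coroot comp_weight_def comp_depth_def)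

lemma wt_weight: "wtJ x \<in> weights \<alpha> J"
  by (auto simp: wt_def weights_def)

text \<open>Both sides grow by \<open>\<alpha> j\<close> along an edge of color \<open>j\<close>, so
  they agree on the whole component.\<close>

lemma wt_component:
  assumes "j \<in> J" "y \<in> compt j x"
  shows "wtJ y = wtJ x + (real (rk j y) - real (rk j x)) *\<^sub>R \<alpha> j"
proof -
  have step: "wtJ t = wtJ s + \<alpha> j" "rk j t = rk j s + 1" if "(s, t) \<in> edges j" for s t
    using structured that assms(1) comp_rank_edge[OF that]
    by (auto simp: structured_def color_edges_def)
  from assms(2) show ?thesis
    by (induction rule: component_induct) (auto simp: step algebra_simps dest!: step)
qed

text \<open>The reflection subtracts \<open>c + 2 * rk j y - len j x\<close> times
  \<open>\<alpha> j\<close>; the condition on the ranks turns this number into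
  \<open>rk j y - rk j z\<close>, by which the two weights differ in units of
  \<open>\<alpha> j\<close>.\<close>

lemma wt_reflection:
  assumes j: "j \<in> J" and yz: "y \<in> compt j x" "z \<in> compt j x"
    and \<nu>: "\<nu> \<bullet> coroot (\<alpha> j) = c" and rank: "real (rk j y) + real (rk j z) + c = real (len j x)"
  shows "root_reflection (\<alpha> j) (\<nu> + wtJ y) = \<nu> + wtJ z"
proof -
  have "len j y = len j x" using comp_length_eq yz by blast
  then have "root_reflection (\<alpha> j) (\<nu> + wtJ y) =
      \<nu> + wtJ y - (c + 2 * real (rk j y) - real (len j x)) *\<^sub>R \<alpha> j"
    by (simp add: root_reflection_def inner_add_left wt_coroot j \<nu>)
  also have "c + 2 * real (rk j y) - real (len j x) = real (rk j y) - real (rk j z)"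
    using rank by simp
  also have "\<nu> + wtJ y - (real (rk j y) - real (rk j z)) *\<^sub>R \<alpha> j = \<nu> + wtJ z"
    unfolding wt_component[OF j yz(1)] wt_component[OF j yz(2)] by (simp add: algebra_simps)
  finally show ?thesis .
qed

text \<open>On a \<open>j\<close>-component of length \<open>l\<close> the simple reflection moves
  the weight at rank \<open>k\<close> to the one at rank \<open>l - k\<close>, and by symmetry these
  ranks are equally large. Words in simple reflections give the whole group.\<close>

lemma weyl_invariant_if_rank_symmetric:
  assumes sym: "\<And>j x. j \<in> J \<Longrightarrow> x \<in> R \<Longrightarrow> rank_symmetric (compt j x) (comp_ord j x)"
  shows "weyl_invariant \<Phi> (\<Sum>x\<in>R. frag_of (wtJ x))"
proof -
  let ?X = "\<Sum>x\<in>R. frag_of (wtJ x)"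
  \<comment> \<open>Stated for arbitrary \<open>F\<close>, so that the induction over words can pass
    to \<open>F\<close> composed with a reflection.\<close>
  have simple: "(\<Sum>x\<in>R. F (root_reflection (\<alpha> j) (wtJ x))) = (\<Sum>x\<in>R. F (wtJ x))"
    if j: "j \<in> J" for j and F :: "real^'n \<Rightarrow> ((real^'n) \<Rightarrow>\<^sub>0 int)"
  proof (rule sum_over_components[where j = j])
    fix x assume x: "x \<in> R"
    \<comment> \<open>Within one component the weight is a function of the rank; \<open>h\<close> is
      \<open>F\<close> expressed through it.\<close>
    define h where "h k = F (wtJ x + (real k - real (rk j x)) *\<^sub>R \<alpha> j)" for k
    have "F (root_reflection (\<alpha> j) (wtJ y)) = h (len j x - rk j y)" if y: "y \<in> compt j x" for y
    proof -
      have "len j y = len j x" using comp_length_eq y by blast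
      moreover have "rk j y \<le> len j x"
        using comp_rank_le[of y j] component_subset[OF x] y calculation by auto
      ultimately have "root_reflection (\<alpha> j) (wtJ y) = wtJ y - (2 * real (rk j y) - real (len j x)) *\<^sub>R \<alpha> j"
        by (simp add: root_reflection_def wt_coroot[OF j])
      also have "\<dots> = wtJ x + ((real (rk j y) - real (rk j x)) - (2 * real (rk j y) - real (len j x))) *\<^sub>R \<alpha> j"
        unfolding wt_component[OF j y] scaleR_left_diff_distrib[of "_ - _" "_ - _"] by simp
      also have "(real (rk j y) - real (rk j x)) - (2 * real (rk j y) - real (len j x)) =
          real (len j x - rk j y) - real (rk j x)"
        using \<open>rk j y \<le> len j x\<close> by (simp add: of_nat_diff)
      finally have "root_reflection (\<alpha> j) (wtJ y) =
          wtJ x + (real (len j x - rk j y) - real (rk j x)) *\<^sub>R \<alpha> j" .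
      then show ?thesis by (simp add: h_def)
    qed
    then have "(\<Sum>y\<in>compt j x. F (root_reflection (\<alpha> j) (wtJ y))) = (\<Sum>y\<in>compt j x. h (len j x - rk j y))"
      by simp
    also have "\<dots> = (\<Sum>y\<in>compt j x. h (rk j y))"
      by (rule sum_rank_symmetric[OF x sym[OF j x]])
    also have "\<dots> = (\<Sum>y\<in>compt j x. F (wtJ y))"
      by (intro sum.cong) (auto simp: h_def wt_component[OF j])
    finally show "(\<Sum>y\<in>compt j x. F (root_reflection (\<alpha> j) (wtJ y))) = (\<Sum>y\<in>compt j x. F (wtJ y))" .
  qed
  have word: "(\<Sum>x\<in>R. F (reflection_word \<alpha> js (wtJ x))) = (\<Sum>x\<in>R. F (wtJ x))"
    if "set js \<subseteq> J" for js and F :: "real^'n \<Rightarrow> ((real^'n) \<Rightarrow>\<^sub>0 int)"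
    using that
  proof (induction js arbitrary: F)
    case (Cons j js)
    then show ?case using simple[of j F] Cons.IH[of "\<lambda>x. F (root_reflection (\<alpha> j) x)"] by simp
  qed simp
  show ?thesis
    unfolding weyl_invariant_def
  proof
    fix w assume "w \<in> W"
    then obtain js where "set js \<subseteq> J" "w = reflection_word \<alpha> js" using weyl_is_word by blast
    then show "map_exponents w ?X = ?X"
      using word[of js frag_of] by (simp add: map_exponents_frag_sum)
  qed
qed

text \<open>The coefficient of \<open>\<omega> j\<close> in the sum is the rank of \<open>x\<close>
  in its \<open>j\<close>-component plus the excess of the coefficient of \<open>\<nu>\<close> over
  the depth, both nonnegative.\<close>

lemma dominant_add_wt:
  assumes "\<nu> \<in> weights \<alpha> J" "x \<in> R" "\<And>j. j \<in> J \<Longrightarrow> comp_depth r col j x \<le> \<nu> \<bullet> coroot (\<alpha> j)"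
  shows "\<nu> + wtJ x \<in> dominant_weights \<alpha> J"
proof -
  have "0 \<le> (\<nu> + wtJ x) \<bullet> coroot (\<alpha> j)" if "j \<in> J" for j
    using assms(3)[OF that] by (simp add: inner_add_left wt_coroot that comp_depth_def)
  then show ?thesis
    using assms(1) weights_add wt_weight by (simp add: dominant_weights_iff dominant_def)
qed

lemma kindred_alternant_sum:
  assumes "\<And>j. j \<in> J \<Longrightarrow> \<nu> \<bullet> coroot (\<alpha> j) = real (n j)" "\<kappa> x \<in> J"
    and "is_sub_block (compt (\<kappa> x) x) (comp_ord (\<kappa> x) x) (n (\<kappa> x) + 1) (kindred R r col S \<kappa> x)"
  shows "(\<Sum>y\<in>kindred R r col S \<kappa> x. alternant \<Phi> (\<nu> + \<rho> + wtJ y)) = 0"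
proof (rule frag_eq_uminus_zero, rule sub_block_sum_eq_zero[OF assms(3)])
  fix y z assume yz: "y \<in> compt (\<kappa> x) x" "z \<in> compt (\<kappa> x) x"
    "rk (\<kappa> x) y + rk (\<kappa> x) z + (n (\<kappa> x) + 1) = len (\<kappa> x) x"
  \<comment> \<open>The summand 1 is the contribution of \<open>\<rho>\<close> and matches the
    parameter of the sub-block.\<close>
  have "(\<nu> + \<rho>) \<bullet> coroot (\<alpha> (\<kappa> x)) = real (n (\<kappa> x) + 1)"
    using assms(1,2) by (simp add: inner_add_left weyl_vector_coroot)
  then have "root_reflection (\<alpha> (\<kappa> x)) (\<nu> + \<rho> + wtJ y) = \<nu> + \<rho> + wtJ z"
    using yz by (intro wt_reflection[OF assms(2)]) (auto simp flip: of_nat_add)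
  then show "alternant \<Phi> (\<nu> + \<rho> + wtJ z) = - alternant \<Phi> (\<nu> + \<rho> + wtJ y)"
    using alternant_simple_reflection[OF assms(2)] by metis
qed simp

lemma splitting_identity:
  assumes \<Psi>: "root_subsystem \<Psi> \<alpha> J = \<Phi>"
    and n: "\<And>j. j \<in> J \<Longrightarrow> \<nu> \<bullet> coroot (\<alpha> j) = real (n j)" and \<nu>: "\<nu> \<in> weights \<alpha> J"
    and inv: "weyl_invariant \<Phi> (\<Sum>x\<in>R. frag_of (wtJ x))"
    and "S \<subseteq> R" and \<kappa>: "\<And>x. x \<in> R - S \<Longrightarrow> \<kappa> x \<in> J"
    and block: "\<And>x. x \<in> R - S \<Longrightarrow>
      is_sub_block (compt (\<kappa> x) x) (comp_ord (\<kappa> x) x) (n (\<kappa> x) + 1) (kindred R r col S \<kappa> x)"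
  shows "bialternant \<Psi> \<alpha> J \<nu> * (\<Sum>x\<in>R. frag_of (wtJ x)) =
    (\<Sum>s\<in>S. bialternant \<Psi> \<alpha> J (\<nu> + wtJ s))"
proof (rule weyl_denominator_cancel)
  let ?A = "alternant \<Phi>"
  have "?A \<rho> * (bialternant \<Psi> \<alpha> J \<nu> * (\<Sum>x\<in>R. frag_of (wtJ x))) =
      ?A (\<nu> + \<rho>) * (\<Sum>x\<in>R. frag_of (wtJ x))"
    by (simp add: weyl_denominator_mult_bialternant[OF \<Psi> \<nu>] flip: mult.assoc)
  also have "\<dots> = (\<Sum>x\<in>R. ?A (\<nu> + \<rho> + wtJ x))"
    using inv by (intro alternant_mult_invariant) (auto simp: weyl_invariant_def)
  also have "\<dots> = (\<Sum>x\<in>R - S. ?A (\<nu> + \<rho> + wtJ x)) + (\<Sum>x\<in>S. ?A (\<nu> + \<rho> + wtJ x))"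
    using \<open>S \<subseteq> R\<close> by (intro sum.subset_diff) auto
  also have "(\<Sum>x\<in>R - S. ?A (\<nu> + \<rho> + wtJ x)) = 0"
    using \<kappa> block by (intro sum_over_kindred[where \<kappa> = \<kappa>] kindred_alternant_sum[where n = n] n) auto
  also have "0 + (\<Sum>x\<in>S. ?A (\<nu> + \<rho> + wtJ x)) = ?A \<rho> * (\<Sum>s\<in>S. bialternant \<Psi> \<alpha> J (\<nu> + wtJ s))"
    using \<nu> wt_weight weights_add
    by (simp add: sum_distrib_left weyl_denominator_mult_bialternant[OF \<Psi>] algebra_simps)
  finally show "?A \<rho> * (bialternant \<Psi> \<alpha> J \<nu> * (\<Sum>x\<in>R. frag_of (wtJ x))) =
    ?A \<rho> * (\<Sum>s\<in>S. bialternant \<Psi> \<alpha> J (\<nu> + wtJ s))" .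
qed

end

text \<open>The coefficients at \<open>J\<close> are the same \<open>comp_weight\<close> values in
  both weights; only the fundamental weights they multiply change.\<close>

lemma restrict_char_WGF:
  assumes "root_basis \<Phi> \<alpha> I" "J \<subseteq> I" "finite R"
  shows "restrict_char \<alpha> J (WGF \<alpha> I R r col) = (\<Sum>x\<in>R. frag_of (wt \<alpha> J r col x))"
proof -
  interpret root_basis \<Phi> \<alpha> I by fact
  have "restrict_weight \<alpha> J (wt \<alpha> I r col x) = wt \<alpha> J r col x" for x
    using assms(2) sum_fund_weight_coroot unfolding restrict_weight_def wt_def
    by (intro sum.cong) auto
  then show ?thesis
    by (simp add: restrict_char_def WGF_def map_exponents_frag_sum[OF assms(3)])
qed

text \<open>The first conjunct is the sufficient condition for invariance given in parentheses in
  the English statement. The final claim is conditional because \<open>splitting_poset\<close> asks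
  for the structure property with respect to all of \<open>I\<close>, whereas dominance and the
  identity follow from the property for \<open>J\<close> and are therefore stated on their
  own.\<close>

theorem corollary8p2:
  fixes \<Phi> :: "(real^'n) set" and \<alpha> :: "'i \<Rightarrow> real^'n" and I J :: "'i set"
    and \<nu> :: "real^'n" and n :: "'i \<Rightarrow> nat"
    and R :: "'p set" and r :: "'p rel" and col :: "'p \<Rightarrow> 'p \<Rightarrow> 'i"
  assumes "root_system \<Phi>" and "simple_roots \<Phi> I \<alpha>" and "J \<subseteq> I"
    and "\<nu> \<in> dominant_weights \<alpha> J" and "\<nu> = (\<Sum>j\<in>J. real (n j) *\<^sub>R fund_weight \<alpha> J j)"
    and "colored_ranked_poset I R r col" and "structured \<alpha> J r col"
  shows
    "((\<forall>j\<in>J. \<forall>x\<in>R. rank_symmetric (component r col j x) (component_order r col j x)) \<longrightarrow>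
        weyl_invariant (root_subsystem \<Phi> \<alpha> J) (restrict_char \<alpha> J (WGF \<alpha> I R r col)))
     \<and>
     (\<forall>(S :: 'p set) (\<kappa> :: 'p \<Rightarrow> 'i).
        weyl_invariant (root_subsystem \<Phi> \<alpha> J) (restrict_char \<alpha> J (WGF \<alpha> I R r col)) \<longrightarrow>
        S \<subseteq> {x \<in> R. \<forall>j\<in>J. comp_depth r col j x \<le> int (n j)} \<longrightarrow>
        (\<forall>x\<in>R - S. \<kappa> x \<in> J) \<longrightarrow>
        (\<forall>x\<in>R - S.
           iso_chain_product (component r col (\<kappa> x) x) (component_order r col (\<kappa> x) x) \<and>
           is_sub_block (component r col (\<kappa> x) x) (component_order r col (\<kappa> x) x)
             (n (\<kappa> x) + 1) (kindred R r col S \<kappa> x)) \<longrightarrow>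
        (\<forall>s\<in>S. \<nu> + wt \<alpha> J r col s \<in> dominant_weights \<alpha> J) \<and>
        bialternant \<Phi> \<alpha> J \<nu> * restrict_char \<alpha> J (WGF \<alpha> I R r col) =
          (\<Sum>s\<in>S. bialternant \<Phi> \<alpha> J (\<nu> + wt \<alpha> J r col s)) \<and>
        (structured \<alpha> I r col \<longrightarrow> splitting_poset \<Phi> \<alpha> I J \<nu> R r col S))"
proof (intro conjI allI impI)
  interpret I: root_basis \<Phi> \<alpha> I
    using assms(1,2) by (simp add: root_basis_def)
  interpret structured_poset "root_subsystem \<Phi> \<alpha> J" \<alpha> J I R r col
    using root_basis_subsystem[OF I.root_basis_axioms assms(3)] assms(6,7)
    by (simp add: structured_poset_def structured_poset_axioms_def colored_poset_def)
  note WGF = restrict_char_WGF[OF I.root_basis_axioms assms(3) finite_R, of r col]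
  have \<nu>: "\<nu> \<in> weights \<alpha> J" using assms(4) dominant_weights_iff by blast
  have n: "\<nu> \<bullet> coroot (\<alpha> j) = real (n j)" if "j \<in> J" for j
    using sum_fund_weight_coroot[OF that] assms(5) by simp
  show "weyl_invariant (root_subsystem \<Phi> \<alpha> J) (restrict_char \<alpha> J (WGF \<alpha> I R r col))"
    if "\<forall>j\<in>J. \<forall>x\<in>R. rank_symmetric (component r col j x) (component_order r col j x)"
    using weyl_invariant_if_rank_symmetric that unfolding WGF by blast
  fix S :: "'p set" and \<kappa> :: "'p \<Rightarrow> 'i"
  assume inv: "weyl_invariant (root_subsystem \<Phi> \<alpha> J) (restrict_char \<alpha> J (WGF \<alpha> I R r col))"
    and S: "S \<subseteq> {x \<in> R. \<forall>j\<in>J. comp_depth r col j x \<le> int (n j)}"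
    and \<kappa>: "\<forall>x\<in>R - S. \<kappa> x \<in> J"
    and block: "\<forall>x\<in>R - S.
      iso_chain_product (component r col (\<kappa> x) x) (component_order r col (\<kappa> x) x) \<and>
      is_sub_block (component r col (\<kappa> x) x) (component_order r col (\<kappa> x) x)
        (n (\<kappa> x) + 1) (kindred R r col S \<kappa> x)"
  show dom: "\<forall>s\<in>S. \<nu> + wt \<alpha> J r col s \<in> dominant_weights \<alpha> J"
  proof
    fix s assume "s \<in> S"
    then have "s \<in> R" and *: "\<And>j. j \<in> J \<Longrightarrow> comp_depth r col j s \<le> int (n j)" using S by auto
    have "comp_depth r col j s \<le> \<nu> \<bullet> coroot (\<alpha> j)" if "j \<in> J" for j
      unfolding n[OF that] using *[OF that] by linarith
    then show "\<nu> + wt \<alpha> J r col s \<in> dominant_weights \<alpha> J"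
      using dominant_add_wt[OF \<nu> \<open>s \<in> R\<close>] by blast
  qed
  show eq: "bialternant \<Phi> \<alpha> J \<nu> * restrict_char \<alpha> J (WGF \<alpha> I R r col) =
      (\<Sum>s\<in>S. bialternant \<Phi> \<alpha> J (\<nu> + wt \<alpha> J r col s))"
    unfolding WGF
    using inv S \<kappa> block by (intro splitting_identity[OF refl n \<nu>]) (auto simp: WGF)
  show "splitting_poset \<Phi> \<alpha> I J \<nu> R r col S" if "structured \<alpha> I r col"
    using that S dom eq assms(6) by (auto simp: splitting_poset_def)
qed

end
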